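(* Let $n\geq 1$ be an integer and let $\mu_2$ be the measure on $\mathbb{R}^2$ given in Cartesian coordinates $(x,y)$ by $\mu_2=C(n)|y|^{n-1}e^{-(x^2+y^2)/2}\,dx\,dy$, with $C(n)=\left(\int_{-\pi/2}^{\pi/2}\cos(t)^{n-1}dt\right)^{-1}$. Let $K_1,K_2$ be two centrally-symmetric convex bodies in $\mathbb{R}^2$. Then there exist two strips $S_1,S_2$ in $\mathbb{R}^2$ such that $$\frac{\mu_2(K_1\cap K_2)}{\mu_2(K_1)\mu_2(K_2)}\geq\frac{\mu_2(S_1\cap S_2)}{\mu_2(S_1)\mu_2(S_2)}.$$
   Context: A strip in $\mathbb{R}^2$ is a set of the form $S=\{z\in\mathbb{R}^2:|z\cdot u|<h\}$ with $u\in\mathbb{S}^1$ and $h>0$. *)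

theory Defs
  imports "HOL-Analysis.Analysis"
begin

definition Cn :: "nat \<Rightarrow> real" where
  "Cn n = 1 / integral {-pi/2..pi/2} (\<lambda>t. cos t ^ (n - 1))"

definition mu2 :: "nat \<Rightarrow> (real \<times> real) measure" where
  "mu2 n = density lborel
     (\<lambda>(x, y). ennreal (Cn n * \<bar>y\<bar> ^ (n - 1) * exp (- (x\<^sup>2 + y\<^sup>2) / 2)))"

definition convex_body :: "(real \<times> real) set \<Rightarrow> bool" where
  "convex_body K \<longleftrightarrow> compact K \<and> convex K \<and> interior K \<noteq> {}"

definition centrally_symmetric :: "(real \<times> real) set \<Rightarrow> bool" where
  "centrally_symmetric K \<longleftrightarrow> (\<forall>z\<in>K. - z \<in> K)"

definition is_strip :: "(real \<times> real) set \<Rightarrow> bool" where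
  "is_strip S \<longleftrightarrow> (\<exists>u h. norm u = 1 \<and> h > 0 \<and> S = {z. \<bar>z \<bullet> u\<bar> < h})"

end

(* For n \<ge> 2 the weight vanishes on the x-axis. Two transversal strips of width about h that are not
   parallel to that axis have measure at least of order h, while their intersection has measure
   O(h^(n+1)); so the right-hand ratio can be made smaller than any positive number.

   For n = 1 the measure is a multiple of the Gaussian measure, and the coordinate strips show that
   the claim follows from the Gaussian correlation inequality g(A \<inter> B) \<ge> g(A) g(B) in the plane. To prove it,
   approximate A by finite intersections of strips and minimise J(A) = g(A \<inter> B) - g(B) g(A) over intersections of
   k strips, with k minimal such that J takes a negative value. At a minimiser, let e be the chord cut
   out of the remaining strips by the boundary line of one strip, at height h say. Stationarity
   of J under translating and tilting the line says that 1_B - g(B) has vanishing integral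
   and first moment on e with respect to the Gaussian weight. As dropping any single strip makes J
   nonnegative, B leaves every strip inside the others. Together with convexity of B this shows that
   the affine contraction T of e onto the parallel chord e' at any larger height maps e \<inter> B onto a set
   containing e' \<inter> B. The Gaussian weight pulled back by T is the weight on e times a convex function,
   and 1_B - g(B) has signs -, +, - on e, so its integral on e' is at most 0. Hence removing
   the strip does not increase J, which contradicts the minimality of k. *)

theory Submission
  imports Defs "HOL-Probability.Probability"
begin

section \<open>The Gaussian measure on the line\<close>

definition gauss1 :: "real measure" where
  "gauss1 = density lborel (\<lambda>x. ennreal (std_normal_density x))"

lemma sets_gauss1 [simp, measurable_cong]: "sets gauss1 = sets borel"
  by (simp add: gauss1_def)

lemma space_gauss1 [simp]: "space gauss1 = UNIV"
  by (simp add: gauss1_def)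

interpretation gauss1: prob_space gauss1
  unfolding gauss1_def by (rule prob_space_normal_density) simp

lemma integral_gauss1:
  fixes f :: "real \<Rightarrow> real"
  assumes [measurable]: "f \<in> borel_measurable borel"
  shows "(\<integral>x. f x \<partial>gauss1) = (\<integral>x. std_normal_density x * f x \<partial>lborel)"
  unfolding gauss1_def by (subst integral_density) auto

lemma integrable_gauss1:
  fixes f :: "real \<Rightarrow> real"
  assumes [measurable]: "f \<in> borel_measurable borel"
  shows "integrable gauss1 f \<longleftrightarrow> integrable lborel (\<lambda>x. std_normal_density x * f x)"
  unfolding gauss1_def by (subst integrable_density) auto

lemma integrable_gauss1_id: "integrable gauss1 (\<lambda>x. x)"
  using integrable_std_normal_moment[of 1] by (simp add: integrable_gauss1)

lemma measure_gauss1: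
  assumes [measurable]: "A \<in> sets borel"
  shows "measure gauss1 A = (\<integral>x. std_normal_density x * indicator A x \<partial>lborel)"
  using integral_gauss1[of "indicator A"] by simp

lemma integrable_indicator_gauss1:
  assumes [measurable]: "A \<in> sets borel"
  shows "integrable lborel (\<lambda>x. std_normal_density x * indicator A x)"
  using integrable_gauss1[of "indicator A"] by (simp add: gauss1.emeasure_finite less_top[symmetric])

lemma std_normal_density_le_1: "std_normal_density x \<le> 1"
proof -
  have "1 \<le> sqrt (2 * pi)" using pi_gt3 by (intro real_le_rsqrt) simp
  moreover have "exp (- x\<^sup>2 / 2) \<le> 1" by simp
  ultimately have "exp (- x\<^sup>2 / 2) \<le> sqrt (2 * pi)" by linarith
  then show ?thesis unfolding std_normal_density_def by (simp add: divide_le_eq)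
qed

text \<open>The density is at most 1. This makes the tails of fibres 1-Lipschitz in the cutting
  height, which supplies the dominating function when a cut is differentiated.\<close>

lemma measure_gauss1_Ioc_le:
  assumes "a \<le> b"
  shows "measure gauss1 {a<..b} \<le> b - a"
proof -
  have "measure gauss1 {a<..b} \<le> (\<integral>x. indicator {a<..b} x \<partial>lborel)"
    unfolding measure_gauss1[of "{a<..b}", simplified]
    using assms by (intro integral_mono integrable_indicator_gauss1)
       (auto intro!: integrable_real_indicator simp: std_normal_density_le_1 split: split_indicator)
  then show ?thesis using assms by simp
qed

lemma gauss1_null_singleton [simp]: "emeasure gauss1 {x} = 0"
  unfolding gauss1_def
  by (subst emeasure_density) (auto intro!: nn_integral_zero' AE_I[where N="{x}"] split: split_indicator)

lemma AE_gauss1_neq: "AE x in gauss1. x \<noteq> a"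
  by (rule AE_I[of _ _ "{a}"]) auto

section \<open>Convex weights and affine images of Gaussian intervals\<close>

text \<open>The affine function is the secant through \<open>p\<close> and \<open>q\<close>. The two
  inequalities have opposite directions, which matches the sign change at \<open>p\<close> and
  \<open>q\<close> of the function integrated later.\<close>

lemma convex_fun_chord:
  fixes f :: "real \<Rightarrow> real"
  assumes f: "convex_on UNIV f" and "p < q"
  obtains c d where "\<And>s. s \<in> {p..q} \<Longrightarrow> f s \<le> c + d * s" "\<And>s. s \<notin> {p..q} \<Longrightarrow> c + d * s \<le> f s"
proof -
  define d where "d = (f q - f p) / (q - p)"
  define c where "c = f p - d * p"
  have l: "c + d * s = ((q - s) * f p + (s - p) * f q) / (q - p)" for s
  proof -
    have "d * (q - p) = f q - f p" using \<open>p < q\<close> by (simp add: d_def)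
    then have "(c + d * s) * (q - p) = (q - s) * f p + (s - p) * f q"
      unfolding c_def by algebra
    then show ?thesis using \<open>p < q\<close> by (simp add: eq_divide_eq)
  qed
  \<comment> \<open>Three-point form of convexity with denominators cleared; it is used with the new
    point in the middle, on the left and on the right.\<close>
  have cv: "(z - x) * f y \<le> (z - y) * f x + (y - x) * f z" if "x < y" "y < z" for x y z
  proof -
    define t where "t = (y - x) / (z - x)"
    have t: "t * (z - x) = y - x" "0 \<le> t" "t \<le> 1" using that by (auto simp: t_def)
    have "f ((1 - t) *\<^sub>R x + t *\<^sub>R z) \<le> (1 - t) * f x + t * f z"
      using t by (intro convex_onD[OF f]) auto
    also have "(1 - t) *\<^sub>R x + t *\<^sub>R z = y"
      using t(1) by (simp add: algebra_simps)
    finally have "(z - x) * f y \<le> (z - x) * ((1 - t) * f x + t * f z)"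
      using that by (intro mult_left_mono) auto
    also have "\<dots> = (z - y) * f x + (y - x) * f z"
      using t(1) by algebra
    finally show ?thesis .
  qed
  show ?thesis
  proof
    fix s assume s: "s \<in> {p..q}"
    show "f s \<le> c + d * s"
    proof (cases "s = p \<or> s = q")
      case True then show ?thesis unfolding l using \<open>p < q\<close> by auto
    next
      case False then show ?thesis unfolding l using cv[of p s q] s \<open>p < q\<close>
        by (simp add: field_simps)
    qed
  next
    fix s assume s: "s \<notin> {p..q}"
    then consider "s < p" | "q < s" by force
    then show "c + d * s \<le> f s"
    proof cases
      case 1 then show ?thesis unfolding l using cv[of s p q] \<open>p < q\<close> by (simp add: field_simps)
    next
      case 2 then show ?thesis unfolding l using cv[of p q s] \<open>p < q\<close> by (simp add: field_simps)
    qed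
  qed
qed

text \<open>The exponent is convex, and \<open>exp\<close> is increasing and convex. Such functions
  arise as quotients of a rescaled Gaussian weight by the original one.\<close>

lemma convex_exp_quadratic:
  fixes \<alpha> \<beta> \<gamma> :: real
  assumes "0 \<le> \<alpha>"
  shows "convex_on UNIV (\<lambda>s. exp (\<alpha> * s\<^sup>2 + \<beta> * s + \<gamma>))"
proof (rule convex_onI)
  fix t x y :: real assume t: "0 < t" "t < 1"
  let ?g = "\<lambda>s. \<alpha> * s\<^sup>2 + \<beta> * s + \<gamma>"
  have "(1 - t) * ?g x + t * ?g y - ?g ((1 - t) * x + t * y) = \<alpha> * (t * (1 - t) * (x - y)\<^sup>2)"
    by (simp add: power2_eq_square algebra_simps)
  moreover have "0 \<le> \<alpha> * (t * (1 - t) * (x - y)\<^sup>2)" using assms t by simp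
  ultimately have "?g ((1 - t) * x + t * y) \<le> (1 - t) * ?g x + t * ?g y" by linarith
  then have "exp (?g ((1 - t) * x + t * y)) \<le> exp ((1 - t) * ?g x + t * ?g y)" by simp
  also have "\<dots> \<le> (1 - t) * exp (?g x) + t * exp (?g y)"
    using convex_onD[OF exp_convex, of t "?g x" "?g y"] t by simp
  finally show "exp (?g ((1 - t) *\<^sub>R x + t *\<^sub>R y)) \<le> (1 - t) * exp (?g x) + t * exp (?g y)"
    by simp
qed simp

text \<open>
  After the substitution \<open>x = \<tau> + \<rho> s\<close> the Gaussian weight becomes a convex multiple \<open>f\<close> of itself;
  replacing \<open>f\<close> by its chord over \<open>[p, q]\<close> only increases the integral of \<open>1\<^bsub>[p, q]\<^esub> - \<kappa> 1\<^bsub>I\<^esub>\<close> against it.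
\<close>

lemma gauss1_affine_compare:
  fixes p q \<tau> \<rho> \<kappa> :: real
  assumes "p < q" and I[measurable]: "I \<in> sets borel" and sub: "{p..q} \<subseteq> I"
    and \<rho>: "0 < \<rho>" "\<rho> \<le> 1" and \<kappa>: "0 \<le> \<kappa>" "\<kappa> \<le> 1"
    and m0: "measure gauss1 {p..q} = \<kappa> * measure gauss1 I"
    and m1: "(\<integral>x. x * indicator {p..q} x \<partial>gauss1) = \<kappa> * (\<integral>x. x * indicator I x \<partial>gauss1)"
  shows "measure gauss1 {\<tau> + \<rho> * p..\<tau> + \<rho> * q} \<le> \<kappa> * measure gauss1 {x. (x - \<tau>) / \<rho> \<in> I}"
proof -
  \<comment> \<open>Quotient of the weights at \<open>\<tau> + \<rho> * s\<close> and at
    \<open>s\<close>. The leading coefficient of its exponent is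
    \<open>(1 - \<rho>\<^sup>2) / 2\<close>, so convexity comes from
    \<open>\<rho> \<le> 1\<close>.\<close>
  define f where "f s = exp (s\<^sup>2 / 2 - (\<tau> + \<rho> * s)\<^sup>2 / 2)" for s
  have fe: "f = (\<lambda>s. exp (((1 - \<rho>\<^sup>2) / 2) * s\<^sup>2 + (- \<tau> * \<rho>) * s + (- (\<tau>\<^sup>2 / 2))))"
    by (auto simp: f_def fun_eq_iff power2_eq_square field_simps)
  have "\<rho>\<^sup>2 \<le> 1" using \<rho> by (simp add: power_le_one)
  then have "convex_on UNIV f" unfolding fe by (intro convex_exp_quadratic) simp
  then obtain c d where cd: "\<And>s. s \<in> {p..q} \<Longrightarrow> f s \<le> c + d * s" "\<And>s. s \<notin> {p..q} \<Longrightarrow> c + d * s \<le> f s"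
    using convex_fun_chord \<open>p < q\<close> by blast
  have fd: "std_normal_density (\<tau> + \<rho> * s) = std_normal_density s * f s" for s
    by (simp add: std_normal_density_def f_def mult_exp_exp)
  define J where "J = {x. (x - \<tau>) / \<rho> \<in> I}"
  have J[measurable]: "J \<in> sets borel" unfolding J_def by measurable
  have affine: "measure gauss1 S = \<rho> * (\<integral>s. std_normal_density s * f s * indicator S (\<tau> + \<rho> * s) \<partial>lborel)"
    "integrable lborel (\<lambda>s. std_normal_density s * f s * indicator S (\<tau> + \<rho> * s))"
    if [measurable]: "S \<in> sets borel" for S
  proof -
    show "measure gauss1 S = \<rho> * (\<integral>s. std_normal_density s * f s * indicator S (\<tau> + \<rho> * s) \<partial>lborel)"
      unfolding measure_gauss1[OF that] using \<rho>
      by (subst lborel_integral_real_affine[where c=\<rho> and t=\<tau>]) (auto simp: fd)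
    show "integrable lborel (\<lambda>s. std_normal_density s * f s * indicator S (\<tau> + \<rho> * s))"
      using lborel_integrable_real_affine[OF integrable_indicator_gauss1[OF that], of \<rho> \<tau>] \<rho>
      by (simp add: fd)
  qed
  have i1: "indicator {\<tau> + \<rho> * p..\<tau> + \<rho> * q} (\<tau> + \<rho> * s) = (indicator {p..q} s :: real)" for s
    using \<rho> by (auto split: split_indicator)
  have i2: "indicator J (\<tau> + \<rho> * s) = (indicator I s :: real)" for s
    using \<rho> by (auto simp: J_def split: split_indicator)
  let ?D = "\<lambda>s. indicator {p..q} s - \<kappa> * indicator I s :: real"
  have a1: "measure gauss1 {\<tau> + \<rho> * p..\<tau> + \<rho> * q} - \<kappa> * measure gauss1 J
     = \<rho> * (\<integral>s. std_normal_density s * f s * ?D s \<partial>lborel)"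
    using affine[of "{\<tau> + \<rho> * p..\<tau> + \<rho> * q}"] affine[OF J]
    unfolding i1 i2 by (simp add: algebra_simps)
  have int: "integrable lborel (\<lambda>s. std_normal_density s * f s * ?D s)"
    using affine(2)[of "{\<tau> + \<rho> * p..\<tau> + \<rho> * q}"] affine(2)[OF J]
    unfolding i1 i2 by (simp add: algebra_simps)
  have ix: "integrable gauss1 (\<lambda>x. x * indicator S x)" if "S \<in> sets borel" for S
    using integrable_real_mult_indicator[of S gauss1 "\<lambda>x. x"] that integrable_gauss1_id
    by simp
  \<comment> \<open>The equalities \<open>m0\<close> and \<open>m1\<close> of zeroth and first
    moments annihilate every affine function.\<close>
  have eq: "(\<integral>s. (c + d * s) * ?D s \<partial>gauss1) = 0"
  proof -
    have "(\<integral>s. (c + d * s) * ?D s \<partial>gauss1)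
      = (\<integral>s. c * indicator {p..q} s - c * \<kappa> * indicator I s + (d * (s * indicator {p..q} s)) - d * \<kappa> * (s * indicator I s) \<partial>gauss1)"
      by (intro Bochner_Integration.integral_cong) (auto simp: algebra_simps)
    also have "\<dots> = c * measure gauss1 {p..q} - c * \<kappa> * measure gauss1 I
       + d * (\<integral>s. s * indicator {p..q} s \<partial>gauss1) - d * \<kappa> * (\<integral>s. s * indicator I s \<partial>gauss1)"
      using ix[of I] ix[of "{p..q}"] by (simp add: gauss1.emeasure_finite less_top[symmetric])
    also have "\<dots> = 0" unfolding m0 m1 by (simp add: algebra_simps)
    finally show ?thesis .
  qed
  have "integrable gauss1 (\<lambda>s. (c + d * s) * ?D s)"
  proof -
    have "integrable gauss1 (\<lambda>s. c * indicator {p..q} s - c * \<kappa> * indicator I s + (d * (s * indicator {p..q} s)) - d * \<kappa> * (s * indicator I s))"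
      using ix[of I] ix[of "{p..q}"] by (simp add: gauss1.emeasure_finite less_top[symmetric])
    then show ?thesis by (rule Bochner_Integration.integrable_cong[THEN iffD1, rotated 2]) (auto simp: algebra_simps)
  qed
  then have int2: "integrable lborel (\<lambda>s. std_normal_density s * ((c + d * s) * ?D s))"
    by (subst (asm) integrable_gauss1) auto
  have "(\<integral>s. std_normal_density s * f s * ?D s \<partial>lborel) \<le> (\<integral>s. std_normal_density s * ((c + d * s) * ?D s) \<partial>lborel)"
  proof (rule integral_mono[OF int int2])
    fix s
    \<comment> \<open>Inside \<open>{p..q}\<close> the factor \<open>?D\<close> is
      \<open>1 - \<kappa>\<close> and the chord lies above \<open>f\<close>; outside,
      \<open>?D\<close> is nonpositive and the chord lies below. Both cases give the same
      inequality.\<close>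
    have "f s * ?D s \<le> (c + d * s) * ?D s"
    proof (cases "s \<in> {p..q}")
      case True
      then have "0 \<le> ?D s" using sub \<kappa> by (auto split: split_indicator)
      then show ?thesis using cd(1)[OF True] by (rule mult_right_mono[rotated])
    next
      case False
      then have "?D s \<le> 0" using \<kappa> by (auto split: split_indicator)
      then show ?thesis using cd(2)[OF False] by (rule mult_right_mono_neg[rotated])
    qed
    then show "std_normal_density s * f s * ?D s \<le> std_normal_density s * ((c + d * s) * ?D s)"
      by (simp add: mult.assoc mult_left_mono)
  qed
  also have "\<dots> = 0" using eq by (subst (asm) integral_gauss1) auto
  finally have "\<rho> * (\<integral>s. std_normal_density s * f s * ?D s \<partial>lborel) \<le> 0"
    using \<rho> by (simp add: mult_le_0_iff)
  then show ?thesis using a1 unfolding J_def by linarith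
qed

section \<open>The Gaussian measure in the plane\<close>

definition gauss2 :: "(real \<times> real) measure" where
  "gauss2 = gauss1 \<Otimes>\<^sub>M gauss1"

lemma sets_gauss2 [simp, measurable_cong]: "sets gauss2 = sets borel"
  unfolding gauss2_def sets_pair_measure_cong[OF sets_gauss1 sets_gauss1] by (simp only: borel_prod)

lemma space_gauss2 [simp]: "space gauss2 = UNIV"
  by (simp add: gauss2_def space_pair_measure)

interpretation gauss1_pair: pair_prob_space gauss1 gauss1 ..

interpretation gauss2: prob_space gauss2
  unfolding gauss2_def by (rule gauss1_pair.prob_space_axioms)

text \<open>Tonelli in both orders: horizontal sections serve to compare parallel chords, vertical
  ones to differentiate the mass above a moving line.\<close>

lemma
  assumes K[measurable]: "K \<in> sets (borel :: (real \<times> real) measure)"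
  shows measure_gauss2: "measure gauss2 K = (\<integral>y. measure gauss1 {x. (x, y) \<in> K} \<partial>gauss1)"
    and measure_gauss2': "measure gauss2 K = (\<integral>x. measure gauss1 {y. (x, y) \<in> K} \<partial>gauss1)"
    and measurable_gauss1_section [measurable]: "(\<lambda>y. measure gauss1 {x. (x, y) \<in> K}) \<in> borel_measurable borel"
    and measurable_gauss1_section' [measurable]: "(\<lambda>x. measure gauss1 {y. (x, y) \<in> K}) \<in> borel_measurable borel"
proof -
  have K': "K \<in> sets (gauss1 \<Otimes>\<^sub>M gauss1)"
    using K sets_gauss2 by (simp add: gauss2_def)
  have s: "{x. (x, y) \<in> K} = (\<lambda>x. (x, y)) -` K" "{y. (x, y) \<in> K} = Pair x -` K" for x y by auto
  have m: "(\<lambda>y. emeasure gauss1 ((\<lambda>x. (x, y)) -` K)) \<in> borel_measurable gauss1"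
    "(\<lambda>x. emeasure gauss1 (Pair x -` K)) \<in> borel_measurable gauss1"
    using gauss1_pair.measurable_emeasure_Pair2[OF K'] gauss1.measurable_emeasure_Pair[OF K'] by auto
  show m1: "(\<lambda>y. measure gauss1 {x. (x, y) \<in> K}) \<in> borel_measurable borel"
    using m(1) unfolding s measure_def by simp
  show m2: "(\<lambda>x. measure gauss1 {y. (x, y) \<in> K}) \<in> borel_measurable borel"
    using m(2) unfolding s measure_def by simp
  show "measure gauss2 K = (\<integral>y. measure gauss1 {x. (x, y) \<in> K} \<partial>gauss1)"
    unfolding measure_def gauss2_def gauss1_pair.emeasure_pair_measure_alt2[OF K']
    using m1 by (subst integral_eq_nn_integral) (auto simp: s gauss1.emeasure_eq_measure)
  show "measure gauss2 K = (\<integral>x. measure gauss1 {y. (x, y) \<in> K} \<partial>gauss1)"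
    unfolding measure_def gauss2_def gauss1.emeasure_pair_measure_alt[OF K']
    using m2 by (subst integral_eq_nn_integral) (auto simp: s gauss1.emeasure_eq_measure)
qed

text \<open>Written with \<open>norm\<close>, the density is visibly radial; this is what rotation
  invariance rests on.\<close>

lemma gauss2_density:
  "gauss2 = density lborel (\<lambda>z. ennreal (exp (- (norm z)\<^sup>2 / 2) / (2 * pi)))"
proof -
  have "gauss2 = density (lborel \<Otimes>\<^sub>M lborel) (\<lambda>(x, y). ennreal (std_normal_density x) * ennreal (std_normal_density y))"
    unfolding gauss2_def gauss1_def
    by (rule pair_measure_density)
       (auto intro: lborel.sigma_finite_measure_axioms gauss1.sigma_finite_measure_axioms[unfolded gauss1_def])
  also have "(\<lambda>(x, y). ennreal (std_normal_density x) * ennreal (std_normal_density y))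
     = (\<lambda>z. ennreal (exp (- (norm z)\<^sup>2 / 2) / (2 * pi)))"
    by (auto simp: fun_eq_iff ennreal_mult'[symmetric] std_normal_density_def norm_Pair mult_exp_exp
        diff_divide_distrib add_divide_distrib)
  finally show ?thesis by (simp add: lborel_prod)
qed

section \<open>Shears, rotations and null lines\<close>

text \<open>Integrate first over the coordinate that is moved: with the other one fixed, the shear
  is a translation.\<close>

lemma
  fixes f :: "real \<times> real \<Rightarrow> ennreal"
  assumes [measurable]: "f \<in> borel_measurable borel"
  shows nn_integral_shear_fst: "(\<integral>\<^sup>+z. f (fst z + a * snd z, snd z) \<partial>lborel) = (\<integral>\<^sup>+z. f z \<partial>lborel)"
    and nn_integral_shear_snd: "(\<integral>\<^sup>+z. f (fst z, snd z + a * fst z) \<partial>lborel) = (\<integral>\<^sup>+z. f z \<partial>lborel)"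
proof -
  have shift: "(\<integral>\<^sup>+x. g (x + c) \<partial>lborel) = (\<integral>\<^sup>+x. g x \<partial>lborel)"
    if "g \<in> borel_measurable borel" for g :: "real \<Rightarrow> ennreal" and c
    using nn_integral_real_affine[of g 1 c] that by (simp add: add.commute)
  have m[measurable]: "f \<in> borel_measurable (lborel \<Otimes>\<^sub>M lborel)"
    by (simp add: lborel_prod)
  have "(\<integral>\<^sup>+z. f (fst z + a * snd z, snd z) \<partial>lborel) = (\<integral>\<^sup>+y. \<integral>\<^sup>+x. f (x + a * y, y) \<partial>lborel \<partial>lborel)"
    by (subst lborel_prod[symmetric], subst lborel_pair.nn_integral_snd[symmetric]) (auto simp: split_beta')
  also have "\<dots> = (\<integral>\<^sup>+y. \<integral>\<^sup>+x. f (x, y) \<partial>lborel \<partial>lborel)"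
    by (intro nn_integral_cong shift) measurable
  also have "\<dots> = (\<integral>\<^sup>+z. f z \<partial>lborel)"
    by (subst lborel_prod[symmetric], subst lborel_pair.nn_integral_snd[symmetric]) (auto simp: split_beta')
  finally show "(\<integral>\<^sup>+z. f (fst z + a * snd z, snd z) \<partial>lborel) = (\<integral>\<^sup>+z. f z \<partial>lborel)" .
  have "(\<integral>\<^sup>+z. f (fst z, snd z + a * fst z) \<partial>lborel) = (\<integral>\<^sup>+x. \<integral>\<^sup>+y. f (x, y + a * x) \<partial>lborel \<partial>lborel)"
    by (subst lborel_prod[symmetric], subst lborel.nn_integral_fst[symmetric]) (auto simp: split_beta')
  also have "\<dots> = (\<integral>\<^sup>+x. \<integral>\<^sup>+y. f (x, y) \<partial>lborel \<partial>lborel)"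
    by (intro nn_integral_cong shift) measurable
  also have "\<dots> = (\<integral>\<^sup>+z. f z \<partial>lborel)"
    by (subst lborel_prod[symmetric], subst lborel.nn_integral_fst[symmetric]) (auto simp: split_beta')
  finally show "(\<integral>\<^sup>+z. f (fst z, snd z + a * fst z) \<partial>lborel) = (\<integral>\<^sup>+z. f z \<partial>lborel)" .
qed

text \<open>Here \<open>c\<close> and \<open>s\<close> stand for cosine and sine. The relation
  \<open>c\<^sup>2 + s\<^sup>2 = 1\<close> is assumed where it is used, so that no angle has to be
  chosen.\<close>

definition rotate2 :: "real \<Rightarrow> real \<Rightarrow> real \<times> real \<Rightarrow> real \<times> real" where
  "rotate2 c s z = (c * fst z - s * snd z, s * fst z + c * snd z)"

lemma continuous_on_rotate2 [continuous_intros]: "continuous_on A (rotate2 c s)"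
  unfolding rotate2_def by (intro continuous_intros)

lemma measurable_rotate2 [measurable]: "rotate2 c s \<in> borel_measurable borel"
  by (intro borel_measurable_continuous_onI continuous_intros)

lemma linear_rotate2: "linear (rotate2 c s)"
  by (rule linearI) (auto simp: rotate2_def algebra_simps)

lemma inner_rotate2:
  assumes "c\<^sup>2 + s\<^sup>2 = 1"
  shows "rotate2 c s z \<bullet> rotate2 c s w = z \<bullet> w"
proof -
  have "rotate2 c s z \<bullet> rotate2 c s w = (c\<^sup>2 + s\<^sup>2) * (z \<bullet> w)"
    by (cases z; cases w) (simp add: rotate2_def power2_eq_square algebra_simps)
  then show ?thesis using assms by simp
qed

text \<open>A rotation by less than a half turn is a product of three shears.\<close>

lemma nn_integral_rotate2:
  fixes f :: "real \<times> real \<Rightarrow> ennreal"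
  assumes f[measurable]: "f \<in> borel_measurable borel" and "c\<^sup>2 + s\<^sup>2 = 1" "0 \<le> c"
  shows "(\<integral>\<^sup>+z. f (rotate2 c s z) \<partial>lborel) = (\<integral>\<^sup>+z. f z \<partial>lborel)"
proof -
  \<comment> \<open>This is minus the tangent of half the rotation angle; \<open>0 \<le> c\<close>
    keeps the denominator positive.\<close>
  define a where "a = - s / (1 + c)"
  have ac: "a * (1 + c) = - s" using \<open>0 \<le> c\<close> by (simp add: a_def)
  then have "(1 + c) * (1 + a * s - c) = 0" using assms(2) by algebra
  then have as: "1 + a * s = c" using \<open>0 \<le> c\<close> by simp
  have r1: "x + a * y + a * (y + s * (x + a * y)) = c * x - s * y" for x y
  proof -
    have "x + a * y + a * (y + s * (x + a * y)) = (1 + a * s) * x + a * (1 + (1 + a * s)) * y"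
      by (simp add: algebra_simps)
    then show ?thesis unfolding as ac by simp
  qed
  have r2: "y + s * (x + a * y) = s * x + c * y" for x y
    unfolding as[symmetric] by (simp add: algebra_simps)
  have r: "rotate2 c s z = (let z1 = (fst z + a * snd z, snd z); z2 = (fst z1, snd z1 + s * fst z1)
      in (fst z2 + a * snd z2, snd z2))" for z
    unfolding rotate2_def Let_def fst_conv snd_conv r1 unfolding r2 ..
  have [measurable]: "(\<lambda>z. f (fst z + a * snd z, snd z)) \<in> borel_measurable borel"
    "(\<lambda>z. f (fst z + a * (snd z + s * fst z), snd z + s * fst z)) \<in> borel_measurable borel"
    by (intro measurable_compose[OF _ f] borel_measurable_continuous_onI continuous_intros)+
  show ?thesis unfolding r Let_def fst_conv snd_conv
    using nn_integral_shear_fst[of "\<lambda>z. f (fst z + a * (snd z + s * fst z), snd z + s * fst z)" a]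
      nn_integral_shear_snd[of "\<lambda>z. f (fst z + a * snd z, snd z)" s]
      nn_integral_shear_fst[of f a] by simp
qed

lemma measure_gauss2_rotate2:
  assumes K[measurable]: "K \<in> sets borel" and cs: "c\<^sup>2 + s\<^sup>2 = 1" "0 \<le> c"
  shows "measure gauss2 (rotate2 c s -` K) = measure gauss2 K"
proof -
  have n: "norm (rotate2 c s z) = norm z" for z
    by (simp add: norm_eq_sqrt_inner inner_rotate2[OF cs(1)])
  have [measurable]: "rotate2 c s -` K \<in> sets borel"
    using measurable_sets[OF measurable_rotate2 K] by simp
  have "emeasure gauss2 (rotate2 c s -` K)
    = (\<integral>\<^sup>+z. ennreal (exp (- (norm (rotate2 c s z))\<^sup>2 / 2) / (2 * pi)) * indicator K (rotate2 c s z) \<partial>lborel)"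
    unfolding gauss2_density by (subst emeasure_density) (auto simp: n indicator_def)
  also have "\<dots> = emeasure gauss2 K"
    unfolding gauss2_density
    by (subst nn_integral_rotate2[OF _ cs, of "\<lambda>z. ennreal (exp (- (norm z)\<^sup>2 / 2) / (2 * pi)) * indicator K z"])
       (auto simp: emeasure_density)
  finally show ?thesis by (simp add: measure_def)
qed

text \<open>The half turn has cosine -1, which \<open>measure_gauss2_rotate2\<close> excludes, but
  it is the square of the quarter turn with \<open>c = 0\<close>.\<close>

lemma measure_gauss2_uminus:
  assumes K[measurable]: "K \<in> sets borel"
  shows "measure gauss2 (uminus -` K) = measure gauss2 K"
proof -
  have q: "rotate2 0 1 -` rotate2 0 1 -` K = uminus -` K"
    by (auto simp: rotate2_def prod_eq_iff uminus_prod_def)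
  have "rotate2 0 1 -` K \<in> sets borel"
    using measurable_sets[OF measurable_rotate2 K] by simp
  then have "measure gauss2 (rotate2 0 1 -` rotate2 0 1 -` K) = measure gauss2 K"
    using K by (simp add: measure_gauss2_rotate2)
  then show ?thesis unfolding q .
qed

text \<open>Slice along a coordinate axis that is not parallel to the line: each slice is a single
  point.\<close>

lemma gauss2_line_null:
  fixes u :: "real \<times> real"
  assumes "u \<noteq> 0"
  shows "{z. z \<bullet> u = t} \<in> null_sets gauss2"
proof -
  have "closed {z. z \<bullet> u = t}" by (intro closed_Collect_eq continuous_intros)
  then have [measurable]: "{z. z \<bullet> u = t} \<in> sets borel" by (rule borel_closed)
  obtain a b where u: "u = (a, b)" by fastforce
  have sing: "measure gauss1 {x. x * a + c = t} = 0" if "a \<noteq> 0" for a c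
  proof -
    have "{x. x * a + c = t} = {(t - c) / a}" using that by (auto simp: field_simps)
    then show ?thesis by (simp add: measure_def)
  qed
  have "measure gauss2 {z. z \<bullet> u = t} = 0"
  proof (cases "a = 0")
    case False
    then show ?thesis by (subst measure_gauss2) (auto simp: u sing)
  next
    case True
    then have "b \<noteq> 0" using assms u by (auto simp: zero_prod_def)
    then show ?thesis using True sing[of b 0] by (subst measure_gauss2') (auto simp: u)
  qed
  then show ?thesis by (intro null_setsI) (auto simp: gauss2.emeasure_eq_measure)
qed

lemma emeasure_lborel_interior_nonempty:
  fixes K :: "'a :: euclidean_space set"
  assumes "interior K \<noteq> {}" "K \<in> sets borel"
  shows "emeasure lborel K \<noteq> 0"
proof
  assume "emeasure lborel K = 0"
  then have "emeasure lborel (interior K) = 0"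
    using emeasure_mono[OF interior_subset, of K lborel] assms(2) by simp
  then have "interior K \<in> null_sets lborel" by (auto intro!: null_setsI)
  then have "negligible (interior K)"
    by (simp add: negligible_iff_null_sets null_sets_completionI)
  then show False using open_not_negligible assms(1) by blast
qed

lemma measure_gauss2_pos:
  assumes "interior K \<noteq> {}" and [measurable]: "K \<in> sets borel"
  shows "0 < measure gauss2 K"
proof -
  have "emeasure gauss2 K \<noteq> 0"
  proof
    assume "emeasure gauss2 K = 0"
    then have "(\<integral>\<^sup>+z. ennreal (exp (- (norm z)\<^sup>2 / 2) / (2 * pi)) * indicator K z \<partial>lborel) = 0"
      unfolding gauss2_density by (subst (asm) emeasure_density) auto
    then have "AE z in lborel. ennreal (exp (- (norm z)\<^sup>2 / 2) / (2 * pi)) * indicator K z = 0"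
      by (subst (asm) nn_integral_0_iff_AE) auto
    then have "AE z in lborel. z \<notin> K"
      using pi_gt_zero
      by (auto simp: ennreal_eq_0_iff divide_le_0_iff not_le split: split_indicator_asm elim!: eventually_mono)
    then have "emeasure lborel K = 0"
      using AE_iff_null_sets[of K lborel] by (auto simp: null_sets_def)
    then show False using emeasure_lborel_interior_nonempty[OF assms] by simp
  qed
  then show ?thesis by (simp add: gauss2.emeasure_eq_measure zero_less_measure_iff)
qed

section \<open>Cutting by a moving line\<close>

text \<open>Fundamental theorem of calculus, after splitting off the constant mass below
  \<open>s - 1\<close> so that only a bounded interval is integrated.\<close>

lemma DERIV_gauss1_cdf:
  "((\<lambda>s. measure gauss1 {..s}) has_real_derivative std_normal_density s) (at s)"
proof -
  have cont: "continuous_on A std_normal_density" for A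
    unfolding normal_density_def by (intro continuous_intros) auto
  have "((\<lambda>x. integral {s - 1..x} std_normal_density) has_real_derivative std_normal_density s) (at s within {s - 1..s + 1})"
    by (intro integral_has_real_derivative cont) auto
  then have d: "((\<lambda>x. integral {s - 1..x} std_normal_density) has_real_derivative std_normal_density s) (at s)"
    by (simp add: at_within_Icc_at)
  have "measure gauss1 {..x} = measure gauss1 {..s - 1} + integral {s - 1..x} std_normal_density"
    if "s - 1 < x" for x
  proof -
    have "measure gauss1 {..x} = measure gauss1 {..<s - 1} + measure gauss1 {s - 1..x}"
      using that by (subst gauss1.finite_measure_Union[symmetric]) (auto intro!: arg_cong[where f="measure gauss1"])
    moreover have "measure gauss1 {..<s - 1} = measure gauss1 {..s - 1}"
      by (intro measure_eq_AE) (use AE_gauss1_neq[of "s - 1"] in \<open>auto elim!: eventually_mono\<close>)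
    moreover have "measure gauss1 {s - 1..x} = (LINT y:{s - 1..x}|lborel. std_normal_density y)"
      by (simp add: measure_gauss1 set_lebesgue_integral_def mult.commute)
    moreover have "\<dots> = integral {s - 1..x} std_normal_density"
      by (intro set_borel_integral_eq_integral borel_integrable_atLeastAtMost')
         (rule cont)
    ultimately show ?thesis by simp
  qed
  then have "\<forall>\<^sub>F x in nhds s. measure gauss1 {..x} = measure gauss1 {..s - 1} + integral {s - 1..x} std_normal_density"
    by (intro eventually_nhds_in_open[THEN eventually_mono, of "{s - 1<..}"]) auto
  moreover have "((\<lambda>x. measure gauss1 {..s - 1} + integral {s - 1..x} std_normal_density) has_real_derivative std_normal_density s) (at s)"
    using d by (auto intro!: derivative_eq_intros)
  ultimately show ?thesis by (subst DERIV_cong_ev[OF refl _ refl])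
qed

lemma measurable_section [measurable]:
  fixes K :: "(real \<times> real) set"
  assumes [measurable]: "K \<in> sets borel"
  shows "{x. (x, y) \<in> K} \<in> sets borel" "{y. (x, y) \<in> K} \<in> sets borel"
proof -
  have "(\<lambda>x. (x, y)) -` K \<inter> space borel \<in> sets (borel :: real measure)"
    by (rule measurable_sets[OF _ assms]) (intro borel_measurable_continuous_onI continuous_intros)
  then show "{x. (x, y) \<in> K} \<in> sets borel" by (simp add: vimage_def)
  have "(\<lambda>y. (x, y)) -` K \<inter> space borel \<in> sets (borel :: real measure)"
    by (rule measurable_sets[OF _ assms]) (intro borel_measurable_continuous_onI continuous_intros)
  then show "{y. (x, y) \<in> K} \<in> sets borel" by (simp add: vimage_def)
qed

text \<open>Near \<open>h\<close> the vertical fibre either contains a whole interval, and the tail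
  changes like the distribution function, or misses one because \<open>K\<close> is closed, and the
  tail is constant. Only points of \<open>K\<close> outside its interior are excluded.\<close>

lemma DERIV_gauss1_section_tail:
  fixes K :: "(real \<times> real) set"
  assumes "closed K" and x: "(x, h) \<in> interior K \<or> (x, h) \<notin> K"
  shows "((\<lambda>s. measure gauss1 {y. (x, y) \<in> K \<and> s < y}) has_real_derivative
     - (std_normal_density h * indicator {x. (x, h) \<in> K} x)) (at h)"
proof -
  have [measurable]: "K \<in> sets borel" using assms(1) by (rule borel_closed)
  note sec[measurable] = measurable_section(2)[OF \<open>K \<in> sets borel\<close>]
  have nbhd: "\<exists>e>0. \<forall>y. \<bar>y - h\<bar> < e \<longrightarrow> (x, y) \<in> U" if "open U" "(x, h) \<in> U" for U
  proof -
    obtain e where "e > 0" "ball (x, h) e \<subseteq> U" using \<open>open U\<close> \<open>(x, h) \<in> U\<close> open_contains_ball by blast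
    moreover have "dist (x, h) (x, y) = \<bar>y - h\<bar>" for y by (simp add: dist_Pair_Pair dist_real_def abs_minus_commute)
    ultimately show ?thesis by (metis mem_ball subsetD)
  qed
  let ?M = "\<lambda>s. measure gauss1 {y. (x, y) \<in> K \<and> s < y}"
  have diff: "?M s - ?M t = measure gauss1 {y. (x, y) \<in> K \<and> s < y \<and> y \<le> t}" if "s \<le> t" for s t
  proof -
    have "{y. (x, y) \<in> K \<and> s < y} = {y. (x, y) \<in> K \<and> s < y \<and> y \<le> t} \<union> {y. (x, y) \<in> K \<and> t < y}"
      using that by auto
    moreover have "measure gauss1 \<dots> = measure gauss1 {y. (x, y) \<in> K \<and> s < y \<and> y \<le> t} + ?M t"
      by (intro gauss1.finite_measure_Union) auto
    ultimately show ?thesis by simp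
  qed
  show ?thesis
  proof (cases "(x, h) \<in> K")
    case False
    then obtain e where e: "e > 0" "\<And>y. \<bar>y - h\<bar> < e \<Longrightarrow> (x, y) \<notin> K"
      using nbhd[of "- K"] \<open>closed K\<close> by auto
    have "?M s = ?M h" if "\<bar>s - h\<bar> < e" for s
    proof -
      have "{y. (x, y) \<in> K \<and> s < y} = {y. (x, y) \<in> K \<and> h < y}"
      proof (rule Collect_cong, rule conj_cong[OF refl])
        fix y assume "(x, y) \<in> K"
        then have "e \<le> \<bar>y - h\<bar>" using e(2)[of y] by (meson not_le)
        then show "s < y \<longleftrightarrow> h < y" using that by linarith
      qed
      then show ?thesis by simp
    qed
    then have "\<forall>\<^sub>F s in nhds h. ?M s = ?M h"
      unfolding eventually_nhds_metric dist_real_def using e(1) by blast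
    then show ?thesis using False by (subst DERIV_cong_ev[OF refl _ refl]) auto
  next
    case True
    then have "(x, h) \<in> interior K" using x by blast
    from nbhd[OF open_interior this] obtain e
      where "e > 0" "\<forall>y. \<bar>y - h\<bar> < e \<longrightarrow> (x, y) \<in> interior K" by blast
    then have e: "e > 0" "\<And>y. \<bar>y - h\<bar> < e \<Longrightarrow> (x, y) \<in> K"
      using interior_subset[of K] by blast+
    let ?F = "\<lambda>s. measure gauss1 {..s}"
    have F: "?F t - ?F s = measure gauss1 {s<..t}" if "s \<le> t" for s t
    proof -
      have "{..t} = {..s} \<union> {s<..t}" using that by auto
      moreover have "measure gauss1 ({..s} \<union> {s<..t}) = ?F s + measure gauss1 {s<..t}"
        by (intro gauss1.finite_measure_Union) auto
      ultimately show ?thesis by simp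
    qed
    have M: "?M s - ?M t = ?F t - ?F s" if "\<bar>s - h\<bar> < e" "\<bar>t - h\<bar> < e" "s \<le> t" for s t
    proof -
      have "{y. (x, y) \<in> K \<and> s < y \<and> y \<le> t} = {s<..t}"
        using e(2) that by auto
      then show ?thesis using diff[OF \<open>s \<le> t\<close>] F[OF \<open>s \<le> t\<close>] by simp
    qed
    have "?M s = ?M h + ?F h - ?F s" if "\<bar>s - h\<bar> < e" for s
      using M[of s h] M[of h s] that e(1) by (cases "s \<le> h") auto
    then have "\<forall>\<^sub>F s in nhds h. ?M s = ?M h + ?F h - ?F s"
      unfolding eventually_nhds_metric dist_real_def using e(1) by blast
    then show ?thesis using True
      by (subst DERIV_cong_ev[OF refl _ refl]) (auto intro!: derivative_eq_intros DERIV_gauss1_cdf)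
  qed
qed

lemma horizontal_open_segment:
  fixes x y z h :: real
  assumes "x < y \<and> y < z \<or> z < y \<and> y < x"
  shows "(y, h) \<in> open_segment (x, h) (z, h)"
proof -
  define u where "u = (y - x) / (z - x)"
  have "0 < u" "u < 1" "u * (z - x) = y - x"
    using assms by (auto simp: u_def divide_simps)
  then have "(y, h) = (1 - u) *\<^sub>R (x, h) + u *\<^sub>R (z, h)" by (simp add: algebra_simps)
  then show ?thesis using assms \<open>0 < u\<close> \<open>u < 1\<close> by (auto simp: in_segment)
qed

text \<open>A point of \<open>K\<close> strictly between the interior point and another point of
  \<open>K\<close> is itself interior. So on each side of \<open>x0\<close> there is at most one
  boundary point, namely the end of the chord.\<close>

lemma convex_line_frontier_finite:
  fixes K :: "(real \<times> real) set"
  assumes K: "convex K" and x0: "(x0, h) \<in> interior K"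
  obtains p q where "\<And>x. (x, h) \<in> K \<Longrightarrow> (x, h) \<notin> interior K \<Longrightarrow> x = p \<or> x = q"
proof -
  define B where "B = {x. (x, h) \<in> K \<and> (x, h) \<notin> interior K}"
  have ext: "x' \<le> x" if "x \<in> B" "x0 < x" "(x', h) \<in> K" for x x'
  proof (rule ccontr)
    assume "\<not> x' \<le> x"
    then have "(x, h) \<in> open_segment (x0, h) (x', h)"
      using that by (intro horizontal_open_segment) auto
    then show False
      using in_interior_closure_convex_segment[OF K x0, of "(x', h)"] that closure_subset[of K] by (auto simp: B_def)
  qed
  have ext': "x \<le> x'" if "x \<in> B" "x < x0" "(x', h) \<in> K" for x x'
  proof (rule ccontr)
    assume "\<not> x \<le> x'"
    then have "(x, h) \<in> open_segment (x0, h) (x', h)"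
      using that by (intro horizontal_open_segment) auto
    then show False
      using in_interior_closure_convex_segment[OF K x0, of "(x', h)"] that closure_subset[of K] by (auto simp: B_def)
  qed
  \<comment> \<open>The two choices are the unique boundary points on either side, and arbitrary
    numbers if a side has none.\<close>
  have "x = (SOME x. x \<in> B \<and> x0 < x) \<or> x = (SOME x. x \<in> B \<and> x < x0)" if "x \<in> B" for x
  proof -
    have "x \<noteq> x0" using that x0 by (auto simp: B_def)
    moreover have "x = (SOME x. x \<in> B \<and> x0 < x)" if "x0 < x"
      using ext[of x] ext[of _ x] \<open>x \<in> B\<close> that
      by (intro some_equality[symmetric]) (auto simp: B_def intro!: antisym)
    moreover have "x = (SOME x. x \<in> B \<and> x < x0)" if "x < x0"
      using ext'[of x] ext'[of _ x] \<open>x \<in> B\<close> that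
      by (intro some_equality[symmetric]) (auto simp: B_def intro!: antisym)
    ultimately show ?thesis by linarith
  qed
  then show ?thesis using that by (auto simp: B_def)
qed

text \<open>The line at height \<open>h\<close> moves with vertical speed \<open>a + b * x\<close>:
  \<open>a\<close> translates it and \<open>b\<close> tilts it. Differentiating fibrewise under the
  integral gives minus the flux through the chord, by dominated convergence.\<close>

lemma DERIV_gauss2_tilt:
  fixes K :: "(real \<times> real) set"
  assumes K: "closed K" "convex K" and x0: "(x0, h) \<in> interior K"
  shows "((\<lambda>e. measure gauss2 (K \<inter> {z. h + e * (a + b * fst z) < snd z})) has_real_derivative
     - (std_normal_density h * (\<integral>x. (a + b * x) * indicator {x. (x, h) \<in> K} x \<partial>gauss1))) (at 0)"
proof -
  have [measurable]: "K \<in> sets borel" using K(1) by (rule borel_closed)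
  define M where "M x s = measure gauss1 {y. (x, y) \<in> K \<and> s < y}" for x s
  note sec[measurable] = measurable_section(2)[OF \<open>K \<in> sets borel\<close>] measurable_section(1)[OF \<open>K \<in> sets borel\<close>]
  have T[measurable]: "K \<inter> {z. h + e * (a + b * fst z) < snd z} \<in> sets borel" for e
    by (intro sets.Int[OF \<open>K \<in> sets borel\<close>] borel_open open_Collect_less continuous_intros)
  define V where "V e = measure gauss2 (K \<inter> {z. h + e * (a + b * fst z) < snd z})" for e
  have V: "V e = (\<integral>x. M x (h + e * (a + b * x)) \<partial>gauss1)" for e
    unfolding V_def by (subst measure_gauss2'[OF T]) (simp add: M_def)
  have meas[measurable]: "(\<lambda>x. M x (h + e * (a + b * x))) \<in> borel_measurable borel" for e
    using measurable_gauss1_section'[OF T[of e]] by (simp add: M_def)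
  have int: "integrable gauss1 (\<lambda>x. M x (h + e * (a + b * x)))" for e
    by (intro gauss1.integrable_const_bound[where B=1]) (auto simp: M_def)
  \<comment> \<open>Bounds the difference quotient at abscissa \<open>x\<close> by
    \<open>\<bar>a\<bar> + \<bar>b\<bar> * \<bar>x\<bar>\<close>, which is Gaussian
    integrable.\<close>
  have lip: "\<bar>M x s - M x t\<bar> \<le> \<bar>s - t\<bar>" for x s t
  proof -
    have *: "0 \<le> M x s - M x t \<and> M x s - M x t \<le> t - s" if "s \<le> t" for s t
    proof -
      have "{y. (x, y) \<in> K \<and> s < y} = {y. (x, y) \<in> K \<and> s < y \<and> y \<le> t} \<union> {y. (x, y) \<in> K \<and> t < y}"
        using that by auto
      moreover have "measure gauss1 \<dots> = measure gauss1 {y. (x, y) \<in> K \<and> s < y \<and> y \<le> t} + M x t"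
        unfolding M_def by (intro gauss1.finite_measure_Union) auto
      moreover have "measure gauss1 {y. (x, y) \<in> K \<and> s < y \<and> y \<le> t} \<le> measure gauss1 {s<..t}"
        by (intro gauss1.finite_measure_mono) auto
      ultimately show ?thesis using measure_gauss1_Ioc_le[OF that] by (simp add: M_def)
    qed
    show ?thesis using *[of s t] *[of t s] by (cases "s \<le> t") auto
  qed
  \<comment> \<open>The fibre derivative may fail only at these two abscissae, which form a null
    set.\<close>
  obtain p q where pq: "\<And>x. (x, h) \<in> K \<Longrightarrow> (x, h) \<notin> interior K \<Longrightarrow> x = p \<or> x = q"
    using convex_line_frontier_finite[OF K(2) x0] by blast
  define L where "L x = - (std_normal_density h * indicator {x. (x, h) \<in> K} x) * (a + b * x)" for x
  have [measurable]: "L \<in> borel_measurable borel" unfolding L_def by measurable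
  have dM: "((\<lambda>e. M x (h + e * (a + b * x))) has_real_derivative L x) (at 0)" if "x \<noteq> p" "x \<noteq> q" for x
  proof -
    have "(x, h) \<in> interior K \<or> (x, h) \<notin> K" using pq that by blast
    then have "(M x has_real_derivative - (std_normal_density h * indicator {x. (x, h) \<in> K} x)) (at (h + 0 * (a + b * x)))"
      unfolding M_def using DERIV_gauss1_section_tail[OF K(1)] by simp
    moreover have "((\<lambda>e. h + e * (a + b * x)) has_real_derivative (a + b * x)) (at 0)"
      by (auto intro!: derivative_eq_intros)
    ultimately show ?thesis unfolding L_def by (rule DERIV_chain2)
  qed
  have "((\<lambda>e. (V (0 + e) - V 0) / e) \<longlongrightarrow> (\<integral>x. L x \<partial>gauss1)) (at 0)"
    \<comment> \<open>Dominated convergence is applied along an arbitrary sequence of nonzero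
      parameters tending to 0.\<close>
    unfolding tendsto_at_iff_sequentially comp_def
  proof safe
    fix X :: "nat \<Rightarrow> real" assume X: "\<forall>i. X i \<in> UNIV - {0}" "X \<longlonglongrightarrow> 0"
    have eq: "(V (0 + X n) - V 0) / X n = (\<integral>x. (M x (h + X n * (a + b * x)) - M x (h + 0 * (a + b * x))) / X n \<partial>gauss1)" for n
      unfolding V using int[of "X n"] int[of 0] by simp
    show "(\<lambda>n. (V (0 + X n) - V 0) / X n) \<longlonglongrightarrow> (\<integral>x. L x \<partial>gauss1)"
      unfolding eq
    proof (rule integral_dominated_convergence[where w="\<lambda>x. \<bar>a\<bar> + \<bar>b\<bar> * \<bar>x\<bar>"])
      show "integrable gauss1 (\<lambda>x. \<bar>a\<bar> + \<bar>b\<bar> * \<bar>x\<bar>)"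
        using integrable_gauss1_id by auto
      have "AE x in gauss1. x \<noteq> p" "AE x in gauss1. x \<noteq> q" by (rule AE_gauss1_neq)+
      then show "AE x in gauss1. (\<lambda>n. (M x (h + X n * (a + b * x)) - M x (h + 0 * (a + b * x))) / X n) \<longlonglongrightarrow> L x"
      proof eventually_elim
        case (elim x)
        from dM[OF elim] have "((\<lambda>e. (M x (h + (0 + e) * (a + b * x)) - M x (h + 0 * (a + b * x))) / e) \<longlongrightarrow> L x) (at 0)"
          by (simp add: DERIV_def)
        then show ?case using X unfolding tendsto_at_iff_sequentially comp_def by simp
      qed
      fix n
      show "AE x in gauss1. norm ((M x (h + X n * (a + b * x)) - M x (h + 0 * (a + b * x))) / X n) \<le> \<bar>a\<bar> + \<bar>b\<bar> * \<bar>x\<bar>"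
      proof (rule AE_I2)
        fix x
        have "X n \<noteq> 0" using X by auto
        have "\<bar>M x (h + X n * (a + b * x)) - M x (h + 0 * (a + b * x))\<bar> \<le> \<bar>X n\<bar> * \<bar>a + b * x\<bar>"
          using lip[of x "h + X n * (a + b * x)" "h + 0 * (a + b * x)"] by (simp add: abs_mult)
        also have "\<dots> \<le> \<bar>X n\<bar> * (\<bar>a\<bar> + \<bar>b\<bar> * \<bar>x\<bar>)"
          by (intro mult_left_mono order_trans[OF abs_triangle_ineq]) (auto simp: abs_mult)
        finally show "norm ((M x (h + X n * (a + b * x)) - M x (h + 0 * (a + b * x))) / X n) \<le> \<bar>a\<bar> + \<bar>b\<bar> * \<bar>x\<bar>"
          using \<open>X n \<noteq> 0\<close> by (simp add: divide_le_eq mult.commute)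
      qed
    qed (use meas[of 0] in simp_all)
  qed
  moreover have "(\<integral>x. L x \<partial>gauss1) = - (std_normal_density h * (\<integral>x. (a + b * x) * indicator {x. (x, h) \<in> K} x \<partial>gauss1))"
  proof -
    have "L = (\<lambda>x. (- std_normal_density h) * ((a + b * x) * indicator {x. (x, h) \<in> K} x))"
      by (auto simp: L_def fun_eq_iff)
    then show ?thesis by (simp only: integral_mult_right_zero)
  qed
  ultimately show ?thesis unfolding V_def DERIV_def by simp
qed

section \<open>Parallel sections\<close>

text \<open>Here \<open>w\<close> is the right end of the polygon and \<open>q\<close> the right end
  of the chord of \<open>B\<close> inside it. The margin between them cannot shrink above
  \<open>h\<close>. Otherwise take the side \<open>j\<close> that is active at height
  \<open>y\<close> and join \<open>(x, y)\<close> to a point of \<open>B\<close> beyond side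
  \<open>j\<close> at height at most \<open>h\<close>: the segment crosses height \<open>h\<close>
  to the right of \<open>q\<close>.\<close>

lemma right_end_bound:
  fixes B :: "(real \<times> real) set" and s m :: "'i \<Rightarrow> real" and J :: "'i set" and h :: real
  defines "w \<equiv> \<lambda>y. Min ((\<lambda>j. s j + m j * y) ` J)"
  assumes B: "convex B" and J: "finite J" "J \<noteq> {}"
    and out: "\<And>j. j \<in> J \<Longrightarrow> \<exists>z\<in>B. snd z \<le> h \<and> s j + m j * snd z < fst z"
    and q: "(q, h) \<in> B" "q < w h" "\<And>x. q \<le> x \<Longrightarrow> x \<le> w h \<Longrightarrow> (x, h) \<in> B \<Longrightarrow> x \<le> q"
    and xy: "(x, y) \<in> B" "h < y"
  shows "x \<le> w y - (w h - q)"
proof (rule ccontr)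
  assume neg: "\<not> x \<le> w y - (w h - q)"
  have "w y \<in> (\<lambda>j. s j + m j * y) ` J" unfolding w_def using J by (intro Min_in) auto
  then obtain j where j: "j \<in> J" "w y = s j + m j * y" by blast
  have wh: "w h \<le> s j + m j * h" unfolding w_def using J j by (intro Min_le) auto
  obtain z1 z2 where z: "(z1, z2) \<in> B" "z2 \<le> h" "s j + m j * z2 < z1" using out[OF j(1)] by auto
  define d where "d = w h - q"
  \<comment> \<open>Weight at which the segment from \<open>(z1, z2)\<close> to
    \<open>(x, y)\<close> has height \<open>h\<close>.\<close>
  define t where "t = (h - z2) / (y - z2)"
  have t: "0 \<le> t" "t < 1" "t * (y - z2) = h - z2" using z xy by (auto simp: t_def divide_simps)
  define x' where "x' = (1 - t) * z1 + t * x"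
  have "(1 - t) *\<^sub>R (z1, z2) + t *\<^sub>R (x, y) \<in> B"
    using t by (intro convexD_alt[OF B z(1) xy(1)]) auto
  moreover have "(1 - t) * z2 + t * y = h" using t(3) by algebra
  ultimately have x': "(x', h) \<in> B" by (simp add: x'_def)
  have "0 < d" using q(2) by (simp add: d_def)
  have "(1 - t) * (s j + m j * z2) < (1 - t) * z1" using z t by (intro mult_strict_left_mono) auto
  moreover have "t * (s j + m j * y - d) \<le> t * x" using neg t j by (intro mult_left_mono) (auto simp: d_def)
  ultimately have "(1 - t) * (s j + m j * z2) + t * (s j + m j * y - d) < x'" by (simp add: x'_def)
  moreover have "(1 - t) * (s j + m j * z2) + t * (s j + m j * y - d) = s j + m j * h - t * d"
    using t(3) by algebra
  moreover have "t * d \<le> d" using t \<open>0 < d\<close> by (simp add: mult_left_le_one_le)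
  ultimately have gt: "q < x'" using wh by (simp add: d_def)
  \<comment> \<open>The crossing may lie outside the polygon; convexity of \<open>B\<close> then
    puts the end \<open>w h\<close> of the polygon's chord into \<open>B\<close>, so maximality of
    \<open>q\<close> applies in either case.\<close>
  have "(min x' (w h), h) \<in> B"
  proof (cases "x' \<le> w h")
    case True then show ?thesis using x' by (simp add: min_def)
  next
    case False
    then have "(w h, h) \<in> open_segment (q, h) (x', h)" using q(2) by (intro horizontal_open_segment) auto
    then have "(w h, h) \<in> closed_segment (q, h) (x', h)" by (simp add: open_segment_def)
    then show ?thesis using B q(1) x' False convex_contains_segment[of B] by (auto simp: min_def)
  qed
  then have "min x' (w h) \<le> q" using gt q by (intro q(3)) auto
  then show False using gt q(2) by simp
qed

text \<open>An empty section is covered as well, with \<open>q < p\<close>.\<close>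

lemma convex_compact_section:
  fixes K :: "(real \<times> real) set"
  assumes "compact K" "convex K"
  obtains p q where "{x. (x, h) \<in> K} = {p..q}"
proof -
  have e: "{x. (x, h) \<in> K} = fst ` (K \<inter> {z. snd z = h})" by force
  have "closed {z :: real \<times> real. snd z = h}" by (intro closed_Collect_eq continuous_intros)
  then have "compact {x. (x, h) \<in> K}" unfolding e
    using assms(1) by (intro compact_continuous_image compact_Int_closed continuous_intros)
  moreover have "convex {x. (x, h) \<in> K}"
  proof (rule convexI)
    fix x y u v :: real assume *: "x \<in> {x. (x, h) \<in> K}" "y \<in> {x. (x, h) \<in> K}" "0 \<le> u" "0 \<le> v" "u + v = 1"
    then have "u *\<^sub>R (x, h) + v *\<^sub>R (y, h) \<in> K" by (intro convexD[OF assms(2)]) auto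
    moreover have "u * h + v * h = h" using *(5) by (metis distrib_right mult_1)
    ultimately show "u *\<^sub>R x + v *\<^sub>R y \<in> {x. (x, h) \<in> K}" by simp
  qed
  ultimately show ?thesis using that connected_compact_interval_1[of "{x. (x, h) \<in> K}"] convex_connected
    by (metis box_real(2))
qed

lemma interior_horizontal_interval:
  fixes K :: "(real \<times> real) set"
  assumes "(x0, h) \<in> interior K" 
  obtains e where "0 < e" "(x0 - e, h) \<in> K" "(x0 + e, h) \<in> K"
proof -
  obtain e where e: "e > 0" "cball (x0, h) e \<subseteq> K" using assms by (auto simp: mem_interior_cball)
  then have "(x0 - e, h) \<in> K" "(x0 + e, h) \<in> K"
    by (auto intro!: subsetD[OF e(2)] simp: dist_Pair_Pair dist_real_def)
  then show ?thesis using that e by blast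
qed

text \<open>Case of a single strip, where the surrounding polygon is the whole plane. Symmetry and
  convexity of \<open>B\<close> put a translate of the chord at height \<open>y\<close> into the
  chord at height \<open>h\<close>, so the affine comparison is used with ratio 1.\<close>

lemma section_le_strip:
  fixes B :: "(real \<times> real) set"
  assumes B: "compact B" "convex B" "\<And>z. z \<in> B \<Longrightarrow> - z \<in> B"
    and x0: "(x0, h) \<in> interior B" and h: "0 < h" "h < y"
    and \<kappa>: "0 \<le> \<kappa>" "\<kappa> \<le> 1"
    and m0: "measure gauss1 {x. (x, h) \<in> B} = \<kappa>"
    and m1: "(\<integral>x. x * indicator {x. (x, h) \<in> B} x \<partial>gauss1) = \<kappa> * (\<integral>x. x \<partial>gauss1)"
  shows "measure gauss1 {x. (x, y) \<in> B} \<le> \<kappa>"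
proof -
  obtain p q where pq: "{x. (x, h) \<in> B} = {p..q}" using convex_compact_section B by blast
  obtain l r where lr: "{x. (x, y) \<in> B} = {l..r}" using convex_compact_section B by blast
  obtain e where "0 < e" "x0 - e \<in> {p..q}" "x0 + e \<in> {p..q}"
    using interior_horizontal_interval[OF x0] pq[symmetric] by auto
  then have "p < q" by auto
  show ?thesis
  proof (cases "l \<le> r")
    case False then show ?thesis using \<kappa> by (simp add: lr)
  next
    case True
    then have lB: "(l, y) \<in> B" "(r, y) \<in> B" using lr by auto
    then have nB: "(- l, - y) \<in> B" "(- r, - y) \<in> B" using B(3) by force+
    \<comment> \<open>Chosen so that heights \<open>- y\<close> and \<open>y\<close> average to
      \<open>h\<close>. Combining each end of the upper chord with the reflection of the other end
      shifts both ends by the same \<open>\<tau>\<close>.\<close>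
    define t where "t = (1 + h / y) / 2"
    define \<tau> where "\<tau> = (1 - t) * (l + r)"
    have t: "0 \<le> t" "t \<le> 1" "(2 * t - 1) * y = h" using h by (auto simp: t_def divide_simps)
    have "(1 - t) *\<^sub>R (- l, - y) + t *\<^sub>R (r, y) \<in> B" "(1 - t) *\<^sub>R (- r, - y) + t *\<^sub>R (l, y) \<in> B"
      using t by (intro convexD_alt[OF B(2)] lB nB; simp)+
    moreover have "(1 - t) * - y + t * y = h" using t(3) by (simp add: algebra_simps)
    moreover have "(1 - t) * - l + t * r = r - \<tau>" "(1 - t) * - r + t * l = l - \<tau>"
      unfolding \<tau>_def by (simp_all add: algebra_simps)
    ultimately have "r - \<tau> \<in> {p..q}" "l - \<tau> \<in> {p..q}" unfolding pq[symmetric] by simp_all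
    then have "{l..r} \<subseteq> {\<tau> + 1 * p..\<tau> + 1 * q}" by auto
    then have "measure gauss1 {l..r} \<le> measure gauss1 {\<tau> + 1 * p..\<tau> + 1 * q}"
      by (intro gauss1.finite_measure_mono) auto
    also have "\<dots> \<le> \<kappa> * measure gauss1 {x. (x - \<tau>) / 1 \<in> UNIV}"
      by (rule gauss1_affine_compare)
         (use \<open>p < q\<close> \<kappa> m0 m1 gauss1.prob_space in \<open>auto simp: pq\<close>)
    finally show ?thesis using gauss1.prob_space by (simp add: lr)
  qed
qed

text \<open>
  Here \<open>gauss1_affine_compare\<close> is applied to the affine map between the sections of \<open>A\<close> at heights \<open>h\<close>
  and \<open>y\<close>; in \<open>section_le_strip\<close>, where \<open>A\<close> is the plane, the map is a translation read off from \<open>B\<close>.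
\<close>

lemma section_le_polygon:
  fixes B :: "(real \<times> real) set" and s m :: "'i \<Rightarrow> real" and J :: "'i set" and h :: real
  defines "A \<equiv> {z. \<forall>j\<in>J. \<bar>fst z - m j * snd z\<bar> \<le> s j}"
  assumes B: "compact B" "convex B" "\<And>z. z \<in> B \<Longrightarrow> - z \<in> B"
    and J: "finite J" "J \<noteq> {}"
    and x0: "(x0, h) \<in> interior (A \<inter> B)" and h: "0 < h" "h < y"
    and out: "\<And>j. j \<in> J \<Longrightarrow> \<exists>z\<in>B. \<bar>snd z\<bar> \<le> h \<and> s j < \<bar>fst z - m j * snd z\<bar>"
    and \<kappa>: "0 \<le> \<kappa>" "\<kappa> \<le> 1"
    and m0: "measure gauss1 {x. (x, h) \<in> A \<inter> B} = \<kappa> * measure gauss1 {x. (x, h) \<in> A}"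
    and m1: "(\<integral>x. x * indicator {x. (x, h) \<in> A \<inter> B} x \<partial>gauss1)
      = \<kappa> * (\<integral>x. x * indicator {x. (x, h) \<in> A} x \<partial>gauss1)"
  shows "measure gauss1 {x. (x, y) \<in> A \<inter> B} \<le> \<kappa> * measure gauss1 {x. (x, y) \<in> A}"
proof -
  \<comment> \<open>The section of \<open>A\<close> at height \<open>y\<close> is
    \<open>{- w' y..w y}\<close>, so the left end is recorded with opposite sign and both ends are
    minima of affine functions.\<close>
  define w where "w = (\<lambda>y. Min ((\<lambda>j. s j + m j * y) ` J))"
  define w' where "w' = (\<lambda>y. Min ((\<lambda>j. s j + - m j * y) ` J))"
  have w_iff: "x \<le> w y \<longleftrightarrow> (\<forall>j\<in>J. x \<le> s j + m j * y)"
    and w'_iff: "x \<le> w' y \<longleftrightarrow> (\<forall>j\<in>J. x \<le> s j + - m j * y)" for x y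
    unfolding w_def w'_def using J by (subst Min_ge_iff; auto)+
  have A: "(x, y) \<in> A \<longleftrightarrow> - w' y \<le> x \<and> x \<le> w y" for x y
  proof -
    have *: "- w' y \<le> x \<longleftrightarrow> - x \<le> w' y" by linarith
    have "\<bar>x - m j * y\<bar> \<le> s j \<longleftrightarrow> - x \<le> s j + - m j * y \<and> x \<le> s j + m j * y" for j
      unfolding abs_le_iff by auto
    then show ?thesis unfolding * w_iff w'_iff A_def by auto
  qed
  have Asec: "{x. (x, y) \<in> A} = {- w' y..w y}" for y using A by auto
  have w_at: "Min ((\<lambda>j. s j + m j * y) ` J) = w y" "Min ((\<lambda>j. s j + - m j * y) ` J) = w' y" for y
    by (simp_all add: w_def w'_def)
  note bound = right_end_bound[where s=s and m=m and J=J, unfolded w_at]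
  note bound' = right_end_bound[where s=s and m="\<lambda>j. - m j" and J=J, unfolded w_at]
  have w'_w: "w' y = w (- y)" for y unfolding w_def w'_def by simp
  have "closed A"
  proof -
    have "A = (\<Inter>j\<in>J. {z. \<bar>fst z - m j * snd z\<bar> \<le> s j})" by (auto simp: A_def)
    then show ?thesis by (auto intro!: closed_INT closed_Collect_le continuous_intros)
  qed
  have "convex A"
  proof (rule convexI)
    fix z z' :: "real \<times> real" and u v :: real assume *: "z \<in> A" "z' \<in> A" "0 \<le> u" "0 \<le> v" "u + v = 1"
    show "u *\<^sub>R z + v *\<^sub>R z' \<in> A" unfolding A_def
    proof safe
      fix j assume "j \<in> J"
      then have z: "\<bar>fst z - m j * snd z\<bar> \<le> s j" "\<bar>fst z' - m j * snd z'\<bar> \<le> s j" using * by (auto simp: A_def)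
      have "fst (u *\<^sub>R z + v *\<^sub>R z') - m j * snd (u *\<^sub>R z + v *\<^sub>R z')
        = u * (fst z - m j * snd z) + v * (fst z' - m j * snd z')" by (simp add: algebra_simps)
      also have "\<bar>\<dots>\<bar> \<le> u * s j + v * s j"
        using z * by (intro order_trans[OF abs_triangle_ineq] add_mono) (auto simp: abs_mult intro: mult_left_mono)
      also have "\<dots> = s j" using *(5) by (metis distrib_right mult_1)
      finally show "\<bar>fst (u *\<^sub>R z + v *\<^sub>R z') - m j * snd (u *\<^sub>R z + v *\<^sub>R z')\<bar> \<le> s j" .
    qed
  qed
  obtain p q where pq: "{x. (x, h) \<in> A \<inter> B} = {p..q}"
    using convex_compact_section[of "A \<inter> B" h] \<open>closed A\<close> \<open>convex A\<close> B
    by (metis closed_Int_compact convex_Int)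
  obtain e where "0 < e" "x0 - e \<in> {p..q}" "x0 + e \<in> {p..q}"
    using interior_horizontal_interval[OF x0] pq[symmetric] by (metis mem_Collect_eq)
  then have "p < q" by auto
  then have "p \<in> {x. (x, h) \<in> A \<inter> B}" "q \<in> {x. (x, h) \<in> A \<inter> B}" using pq by auto
  then have pqB: "(p, h) \<in> B" "(q, h) \<in> B" and pqA: "- w' h \<le> p" "q \<le> w h" by (auto simp: A)
  have in_pq: "x \<in> {p..q}" if "(x, h) \<in> B" "- w' h \<le> x" "x \<le> w h" for x
    using that unfolding pq[symmetric] by (simp add: A)
  \<comment> \<open>The width is even and concave in the height, hence no larger at \<open>y\<close>
    than at \<open>h\<close>. Adding the two instances of \<open>comb\<close> expresses
    this.\<close>
  have width: "w y + w' y \<le> w h + w' h"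
  proof -
    define t where "t = (1 + h / y) / 2"
    have t: "0 \<le> t" "t \<le> 1" "(2 * t - 1) * y = h" using h by (auto simp: t_def divide_simps)
    have comb: "(1 - t) * w (- c) + t * w c \<le> w ((2 * t - 1) * c)" for c
      unfolding w_iff
    proof
      fix j assume "j \<in> J"
      then have "w (- c) \<le> s j + m j * - c" "w c \<le> s j + m j * c" using w_iff by blast+
      then have "(1 - t) * w (- c) + t * w c \<le> (1 - t) * (s j + m j * - c) + t * (s j + m j * c)"
        using t by (intro add_mono mult_left_mono) auto
      also have "\<dots> = s j + m j * ((2 * t - 1) * c)" by (simp add: algebra_simps)
      finally show "(1 - t) * w (- c) + t * w c \<le> s j + m j * ((2 * t - 1) * c)" .
    qed
    have "(1 - t) * w (- y) + t * w y \<le> w h" "(1 - t) * w y + t * w (- y) \<le> w (- h)"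
      using comb[of y] comb[of "- y"] t(3) by simp_all
    then show ?thesis unfolding w'_w by (simp add: algebra_simps)
  qed
  \<comment> \<open>A point of \<open>B\<close> outside strip \<open>j\<close> may lie on either
    side; replacing it by its negative if necessary puts it on the right and keeps its height in
    \<open>[-h, h]\<close>.\<close>
  have right: "x \<le> w y - (w h - q)" if "q < w h" "(x, y) \<in> B" for x
  proof (rule bound[OF B(2) J _ pqB(2) _ _ that(2) h(2)])
    fix j assume "j \<in> J"
    then obtain z where "z \<in> B" "\<bar>snd z\<bar> \<le> h" "s j < \<bar>fst z - m j * snd z\<bar>" using out by blast
    then show "\<exists>z\<in>B. snd z \<le> h \<and> s j + m j * snd z < fst z"
      using B(3)[of z] by (intro bexI[of _ "if 0 \<le> fst z - m j * snd z then z else - z"]) auto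
  qed (use that in_pq pqA \<open>p < q\<close> in \<open>auto intro: antisym\<close>)
  \<comment> \<open>The left end follows from the bound for the right end after reflection in the
    vertical axis, which negates the slopes \<open>m\<close>.\<close>
  let ?R = "\<lambda>z :: real \<times> real. (- fst z, snd z)"
  have left: "- x \<le> w' y - (w' h + p)" if "- w' h < p" "(x, y) \<in> B" for x
  proof -
    have lin: "linear ?R" by (rule linearI) auto
    have memR: "(x, y) \<in> ?R ` B \<longleftrightarrow> (- x, y) \<in> B" for x y by force
    have "- x \<le> w' y - (w' h - (- p))"
    proof (rule bound'[OF convex_linear_image[OF lin B(2)] J _ _ _ _ _ h(2)])
      fix j assume "j \<in> J"
      then obtain z where "z \<in> B" "\<bar>snd z\<bar> \<le> h" "s j < \<bar>fst z - m j * snd z\<bar>" using out by blast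
      then show "\<exists>z\<in>?R ` B. snd z \<le> h \<and> s j + - m j * snd z < fst z"
        using B(3)[of z] by (intro bexI[of _ "?R (if fst z - m j * snd z \<le> 0 then z else - z)"]) auto
    next
      fix x assume "- p \<le> x" "x \<le> w' h" "(x, h) \<in> ?R ` B"
      then show "x \<le> - p"
        using in_pq[of "- x"] pqA \<open>p < q\<close> by (auto simp: memR)
    qed (use that pqB in \<open>auto simp: memR\<close>)
    then show ?thesis by simp
  qed
  show ?thesis
  proof (cases "- w' y < w y")
    \<comment> \<open>The polygon's chord at height \<open>y\<close> is empty or a single point, so
      the left-hand side vanishes.\<close>
    case False
    then have "{x. (x, y) \<in> A \<inter> B} \<subseteq> {w y}" using A by auto
    then have "measure gauss1 {x. (x, y) \<in> A \<inter> B} \<le> measure gauss1 {w y}"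
      by (intro gauss1.finite_measure_mono) auto
    also have "\<dots> = 0" by (simp add: measure_def)
    finally show ?thesis using \<kappa> by (metis measure_nonneg mult_nonneg_nonneg order_trans)
  next
    case True
    \<comment> \<open>The map \<open>\<tau> + \<rho> * x\<close> carries the polygon's chord at
      height \<open>h\<close> onto its chord at height \<open>y\<close>.\<close>
    define \<rho> where "\<rho> = (w y + w' y) / (w h + w' h)"
    define \<tau> where "\<tau> = w y - \<rho> * w h"
    have wh: "0 < w h + w' h" using pqA \<open>p < q\<close> by linarith
    have \<rho>: "0 < \<rho>" "\<rho> \<le> 1" using True width wh by (auto simp: \<rho>_def)
    have \<rho>w: "\<rho> * (w h + w' h) = w y + w' y" using wh by (simp add: \<rho>_def)
    \<comment> \<open>The map multiplies the margins beside \<open>{p..q}\<close> by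
      \<open>\<rho> \<le> 1\<close>, whereas those of \<open>B\<close> do not shrink. Where
      \<open>{p..q}\<close> has no margin, the end of the polygon's chord is itself the
      bound.\<close>
    have "{x. (x, y) \<in> A \<inter> B} \<subseteq> {\<tau> + \<rho> * p..\<tau> + \<rho> * q}"
    proof safe
      fix x assume x: "(x, y) \<in> A" "(x, y) \<in> B"
      have "x \<le> \<tau> + \<rho> * q"
      proof (cases "q < w h")
        case True
        have "\<rho> * (w h - q) \<le> w h - q" using \<rho> True by (simp add: mult_left_le_one_le)
        then show ?thesis using right[OF True x(2)] by (simp add: \<tau>_def algebra_simps)
      next
        case False then show ?thesis using x(1) pqA A by (simp add: \<tau>_def)
      qed
      moreover have "\<tau> + \<rho> * p \<le> x"
      proof (cases "- w' h < p")
        case True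
        have "\<rho> * (w' h + p) \<le> w' h + p" using \<rho> True by (intro mult_left_le_one_le) auto
        then show ?thesis using left[OF True x(2)] \<rho>w by (simp add: \<tau>_def algebra_simps)
      next
        case False
        then have "p = - w' h" using pqA by simp
        then show ?thesis using x(1) A \<rho>w by (simp add: \<tau>_def algebra_simps)
      qed
      ultimately show "x \<in> {\<tau> + \<rho> * p..\<tau> + \<rho> * q}" by simp
    qed
    then have "measure gauss1 {x. (x, y) \<in> A \<inter> B} \<le> measure gauss1 {\<tau> + \<rho> * p..\<tau> + \<rho> * q}"
      by (intro gauss1.finite_measure_mono) auto
    also have "\<dots> \<le> \<kappa> * measure gauss1 {x. (x - \<tau>) / \<rho> \<in> {- w' h..w h}}"
      by (rule gauss1_affine_compare[OF \<open>p < q\<close> _ _ \<rho> \<kappa>])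
         (use pqA m0 m1 in \<open>auto simp only: pq Asec atLeastatMost_subset_iff borel_closed closed_atLeastAtMost\<close>)
    also have "{x. (x - \<tau>) / \<rho> \<in> {- w' h..w h}} = {- w' y..w y}"
    proof -
      have "- w' h \<le> (x - \<tau>) / \<rho> \<longleftrightarrow> - w' y \<le> x" "(x - \<tau>) / \<rho> \<le> w h \<longleftrightarrow> x \<le> w y" for x
        using \<rho> \<rho>w by (simp_all add: le_divide_eq divide_le_eq \<tau>_def algebra_simps) linarith
      then show ?thesis by auto
    qed
    finally show ?thesis by (simp add: Asec)
  qed
qed

section \<open>Removing a strip\<close>

text \<open>
  Only the ray spanned by the pair of normal and half-width matters, so all slabs, including the
  plane and the degenerate ones, are parametrised by the compact unit sphere.
\<close>

definition slab :: "(real \<times> real) \<times> real \<Rightarrow> (real \<times> real) set" where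
  "slab p = {z. \<bar>z \<bullet> fst p\<bar> \<le> snd p}"

definition slabs :: "'i set \<Rightarrow> ('i \<Rightarrow> (real \<times> real) \<times> real) \<Rightarrow> (real \<times> real) set" where
  "slabs I f = (\<Inter>i\<in>I. slab (f i))"

text \<open>The functional to be minimised; its nonnegativity is the correlation inequality for
  \<open>B\<close> and an intersection of slabs.\<close>

definition gap :: "(real \<times> real) set \<Rightarrow> 'i set \<Rightarrow> ('i \<Rightarrow> (real \<times> real) \<times> real) \<Rightarrow> real" where
  "gap B I f = measure gauss2 (slabs I f \<inter> B) - measure gauss2 B * measure gauss2 (slabs I f)"

lemma closed_slab: "closed (slab p)"
  unfolding slab_def by (intro closed_Collect_le continuous_intros)

lemma convex_slab: "convex (slab p)"
proof -
  have "slab p = {z. fst p \<bullet> z \<le> snd p} \<inter> {z. fst p \<bullet> z \<ge> - snd p}"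
    by (auto simp: slab_def inner_commute abs_le_iff)
  then show ?thesis by (simp add: convex_Int convex_halfspace_le convex_halfspace_ge)
qed

lemma uminus_slab: "z \<in> slab p \<Longrightarrow> - z \<in> slab p"
  by (simp add: slab_def)

lemma slab_scale: "0 < c \<Longrightarrow> slab (c *\<^sub>R p) = slab p"
  by (auto simp: slab_def abs_mult)

lemma closed_slabs: "closed (slabs I f)"
  unfolding slabs_def by (intro closed_INT ballI closed_slab)

lemma convex_slabs: "convex (slabs I f)"
  unfolding slabs_def by (intro convex_INT convex_slab)

lemma uminus_slabs: "z \<in> slabs I f \<Longrightarrow> - z \<in> slabs I f"
  by (auto simp: slabs_def uminus_slab)

lemma slabs_in_sets [measurable, simp]: "slabs I f \<in> sets borel"
  by (intro borel_closed closed_slabs)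

lemma slabs_remove: "i \<in> I \<Longrightarrow> slabs I f = slabs (I - {i}) f \<inter> slab (f i)"
  by (auto simp: slabs_def)

lemma slabs_upd: "i \<in> I \<Longrightarrow> slabs I (f(i := p)) = slabs (I - {i}) f \<inter> slab p"
proof -
  have "slabs (I - {i}) (f(i := p)) = slabs (I - {i}) f" by (auto simp: slabs_def)
  then show "i \<in> I \<Longrightarrow> ?thesis" using slabs_remove[of i I "f(i := p)"] by simp
qed

lemma zero_in_interior_slabs:
  assumes "finite I" "\<And>i. i \<in> I \<Longrightarrow> 0 < snd (f i)"
  shows "0 \<in> interior (slabs I f)"
proof (rule interiorI)
  show "open (\<Inter>i\<in>I. {z. \<bar>z \<bullet> fst (f i)\<bar> < snd (f i)})"
    using assms(1) by (intro open_INT ballI open_Collect_less continuous_intros) auto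
  show "0 \<in> (\<Inter>i\<in>I. {z. \<bar>z \<bullet> fst (f i)\<bar> < snd (f i)})" using assms(2) by simp
  show "(\<Inter>i\<in>I. {z. \<bar>z \<bullet> fst (f i)\<bar> < snd (f i)}) \<subseteq> slabs I f"
    by (force simp: slabs_def slab_def)
qed

text \<open>A slab with non-horizontal boundary lines, solved for the abscissa, as
  \<open>section_le_polygon\<close> expects.\<close>

lemma mem_slab_iff_abscissa:
  assumes "\<alpha> \<noteq> 0"
  shows "z \<in> slab ((\<alpha>, \<beta>), t) \<longleftrightarrow> \<bar>fst z - (- \<beta> / \<alpha>) * snd z\<bar> \<le> t / \<bar>\<alpha>\<bar>"
proof -
  have "\<bar>fst z - (- \<beta> / \<alpha>) * snd z\<bar> * \<bar>\<alpha>\<bar> = \<bar>fst z * \<alpha> + snd z * \<beta>\<bar>"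
    using assms by (simp add: abs_mult[symmetric] field_simps)
  then show ?thesis using assms by (simp add: slab_def inner_prod_def le_divide_eq)
qed

text \<open>The slab cuts two caps off \<open>K\<close>, which the point reflection exchanges. They
  are disjoint because \<open>h + e * a\<close> is nonnegative. Thus varying the slab amounts to
  moving a single line.\<close>

lemma measure_gauss2_tilted_slab:
  assumes K[measurable]: "K \<in> sets borel" and sym: "\<And>z. z \<in> K \<Longrightarrow> - z \<in> K" and pos: "0 \<le> h + e * a"
  shows "measure gauss2 (K \<inter> slab ((- (e * b), 1), h + e * a))
    = measure gauss2 K - 2 * measure gauss2 (K \<inter> {z. h + e * (a + b * fst z) < snd z})"
proof -
  let ?U = "{z :: real \<times> real. h + e * (a + b * fst z) < snd z}"
  have [measurable]: "?U \<in> sets borel"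
    by (intro borel_open open_Collect_less continuous_intros)
  have [measurable]: "slab p \<in> sets borel" for p by (intro borel_closed closed_slab)
  have n[measurable]: "uminus -` (K \<inter> ?U) \<in> sets borel"
    using measurable_sets[of uminus borel borel "K \<inter> ?U"] by simp
  have Kn: "- z \<in> K \<longleftrightarrow> z \<in> K" for z using sym[of z] sym[of "- z"] by auto
  have nU: "uminus -` (K \<inter> ?U) = K \<inter> {z. h + e * (a + b * fst (- z)) < snd (- z)}"
    using Kn by auto
  have mem: "z \<in> slab ((- (e * b), 1), h + e * a) \<longleftrightarrow>
      \<not> h + e * (a + b * fst z) < snd z \<and> \<not> h + e * (a + b * fst (- z)) < snd (- z)" for z
    by (simp add: slab_def inner_prod_def abs_le_iff not_less algebra_simps)
  let ?L = "uminus -` (K \<inter> ?U)"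
  have dis: "(K \<inter> ?U) \<inter> ?L = {}"
  proof -
    have False if "h + e * (a + b * fst z) < snd z" "h + e * (a + b * fst (- z)) < snd (- z)" for z :: "real \<times> real"
    proof -
      have "2 * (h + e * a) < 0" using add_strict_mono[OF that] by (simp add: algebra_simps)
      then show False using pos by simp
    qed
    then show ?thesis by (auto simp: nU)
  qed
  have dis': "(K \<inter> slab ((- (e * b), 1), h + e * a)) \<inter> ((K \<inter> ?U) \<union> ?L) = {}"
    unfolding nU using mem by blast
  have "K = (K \<inter> slab ((- (e * b), 1), h + e * a)) \<union> ((K \<inter> ?U) \<union> ?L)"
    unfolding nU using mem by blast
  moreover have "measure gauss2 \<dots> = measure gauss2 (K \<inter> slab ((- (e * b), 1), h + e * a))
      + measure gauss2 ((K \<inter> ?U) \<union> ?L)"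
    using n dis' by (intro gauss2.finite_measure_Union) simp_all
  moreover have "measure gauss2 ((K \<inter> ?U) \<union> ?L) = measure gauss2 (K \<inter> ?U) + measure gauss2 ?L"
    using n dis by (intro gauss2.finite_measure_Union) simp_all
  moreover have "measure gauss2 ?L = measure gauss2 (K \<inter> ?U)"
    by (rule measure_gauss2_uminus) simp
  ultimately show ?thesis by simp
qed

text \<open>Removing slab \<open>i\<close> changes \<open>gap\<close> by twice the
  \<open>B\<close>-part of the upper cap of \<open>A\<close> minus \<open>\<kappa>\<close> times
  that cap. Minimality yields the two moment identities on the boundary chord, the section lemmas
  carry the inequality to each greater height, and integration over the heights shows that the
  change is at most 0.\<close>

lemma gap_remove_horizontal_slab:
  fixes f :: "'i \<Rightarrow> (real \<times> real) \<times> real"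
  assumes B: "compact B" "convex B" "\<And>z. z \<in> B \<Longrightarrow> - z \<in> B" "0 \<in> interior B"
    and I: "finite I" "i \<in> I" and fi: "f i = ((0, 1), h)"
    and pos: "\<And>j. j \<in> I \<Longrightarrow> 0 < snd (f j)"
    and out: "\<And>j. j \<in> I \<Longrightarrow> \<exists>z\<in>B \<inter> slabs (I - {j}) f. z \<notin> slab (f j)"
    and min: "\<And>p. p \<noteq> 0 \<Longrightarrow> gap B I f \<le> gap B I (f(i := p))"
  shows "gap B (I - {i}) f \<le> gap B I f"
proof -
  define J where "J = I - {i}"
  define A where "A = slabs J f"
  define \<kappa> where "\<kappa> = measure gauss2 B"
  have \<kappa>: "0 \<le> \<kappa>" "\<kappa> \<le> 1" by (simp_all add: \<kappa>_def)
  have h: "0 < h" using pos[OF I(2)] fi by simp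
  have A: "closed A" "convex A" "\<And>z. z \<in> A \<Longrightarrow> - z \<in> A"
    unfolding A_def by (simp_all add: closed_slabs convex_slabs uminus_slabs)
  have C: "compact (A \<inter> B)" "convex (A \<inter> B)" using A B by (simp_all add: closed_Int_compact convex_Int)
  have Cc: "closed (A \<inter> B)" using C by (simp add: compact_imp_closed)
  have mA[measurable]: "A \<in> sets borel" and mC[measurable]: "A \<inter> B \<in> sets borel"
    using A Cc by (simp_all add: borel_closed)
  have slab_i: "z \<in> slab (f i) \<longleftrightarrow> \<bar>snd z\<bar> \<le> h" for z
    by (simp add: fi slab_def inner_prod_def)
  obtain z0 where z0: "z0 \<in> A \<inter> B" "h < \<bar>snd z0\<bar>"
    using out[OF I(2)] by (auto simp: A_def J_def slab_i)
  \<comment> \<open>A point of \<open>A \<inter> B\<close> above the slab; the segment from the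
    interior point 0 to it crosses height \<open>h\<close> at an interior point of the
    chord.\<close>
  define z1 where "z1 = (if 0 \<le> snd z0 then z0 else - z0)"
  have z1: "z1 \<in> A \<inter> B" "h < snd z1" using z0 A(3)[of z0] B(3)[of z0] by (auto simp: z1_def)
  have "0 \<in> interior (A \<inter> B)"
    using zero_in_interior_slabs[of J f] I pos B(4) by (simp add: A_def J_def)
  then have seg: "open_segment 0 z1 \<subseteq> interior (A \<inter> B)"
    using in_interior_closure_convex_segment[OF C(2)] z1(1) closure_subset by blast
  define x0 where "x0 = h / snd z1 * fst z1"
  have "(x0, h) \<in> open_segment 0 z1"
    using z1(2) h by (auto simp: in_segment x0_def prod_eq_iff intro!: exI[of _ "h / snd z1"])
  then have x0: "(x0, h) \<in> interior (A \<inter> B)" using seg by blast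
  then have x0A: "(x0, h) \<in> interior A" by simp

  define V where "V K a b e = measure gauss2 (K \<inter> {z. h + e * (a + b * fst z) < snd z})" for K a b e
  \<comment> \<open>Along the family of tilted slabs, \<open>gap\<close> is a constant minus twice
    \<open>V (A \<inter> B) a b e - \<kappa> * V A a b e\<close>, so a minimum of \<open>gap\<close>
    is a maximum of that difference.\<close>
  have G: "gap B I (f(i := ((- (e * b), 1), h + e * a)))
      = measure gauss2 (A \<inter> B) - \<kappa> * measure gauss2 A - 2 * (V (A \<inter> B) a b e - \<kappa> * V A a b e)"
    if "0 \<le> h + e * a" for a b e
  proof -
    let ?S = "slab ((- (e * b), 1), h + e * a)"
    have s: "slabs I (f(i := ((- (e * b), 1), h + e * a))) \<inter> B = (A \<inter> B) \<inter> ?S"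
      "slabs I (f(i := ((- (e * b), 1), h + e * a))) = A \<inter> ?S"
      using I by (auto simp: slabs_upd A_def J_def)
    have "measure gauss2 ((A \<inter> B) \<inter> ?S) = measure gauss2 (A \<inter> B) - 2 * V (A \<inter> B) a b e"
      unfolding V_def by (rule measure_gauss2_tilted_slab[OF mC _ that]) (use A(3) B(3) in auto)
    moreover have "measure gauss2 (A \<inter> ?S) = measure gauss2 A - 2 * V A a b e"
      unfolding V_def by (rule measure_gauss2_tilted_slab[OF mA A(3) that])
    ultimately show ?thesis unfolding gap_def s(1) unfolding s(2) \<kappa>_def
      by (simp only:) (simp add: algebra_simps)
  qed
  have fid: "f(i := ((- (0 * b), 1), h + 0 * a)) = f" for a b :: real using fi by auto
  \<comment> \<open>The choices \<open>(1, 0)\<close> and \<open>(0, 1)\<close> of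
    \<open>(a, b)\<close> will give the identities for mass and first moment.\<close>
  have stationary: "(\<integral>x. (a + b * x) * indicator {x. (x, h) \<in> A \<inter> B} x \<partial>gauss1)
      = \<kappa> * (\<integral>x. (a + b * x) * indicator {x. (x, h) \<in> A} x \<partial>gauss1)" for a b
  proof -
    let ?E = "\<lambda>e. V (A \<inter> B) a b e - \<kappa> * V A a b e"
    have "(?E has_real_derivative
        - (std_normal_density h * (\<integral>x. (a + b * x) * indicator {x. (x, h) \<in> A \<inter> B} x \<partial>gauss1))
        - \<kappa> * - (std_normal_density h * (\<integral>x. (a + b * x) * indicator {x. (x, h) \<in> A} x \<partial>gauss1))) (at 0)"
      unfolding V_def
      by (intro DERIV_diff DERIV_cmult DERIV_gauss2_tilt[OF Cc C(2) x0] DERIV_gauss2_tilt[OF A(1,2) x0A])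
    moreover have "0 < h / (\<bar>a\<bar> + 1)" using h by simp
    \<comment> \<open>The radius is small enough to keep the half-width \<open>h + e * a\<close>
      nonnegative, as formula \<open>G\<close> demands.\<close>
    moreover have "?E e \<le> ?E 0" if "\<bar>0 - e\<bar> < h / (\<bar>a\<bar> + 1)" for e
    proof -
      have "\<bar>e\<bar> * \<bar>a\<bar> \<le> \<bar>e\<bar> * (\<bar>a\<bar> + 1)" by (intro mult_left_mono) auto
      also have "\<dots> < h" using that by (simp add: less_divide_eq)
      finally have "\<bar>e * a\<bar> < h" by (simp add: abs_mult)
      then have pos: "0 \<le> h + e * a" by linarith
      have "gap B I f \<le> gap B I (f(i := ((- (e * b), 1), h + e * a)))"
        by (rule min) (simp add: zero_prod_def)
      then show ?thesis using G[OF pos, of b] G[of 0 a b] h unfolding fid by simp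
    qed
    ultimately have "- (std_normal_density h * (\<integral>x. (a + b * x) * indicator {x. (x, h) \<in> A \<inter> B} x \<partial>gauss1))
        - \<kappa> * - (std_normal_density h * (\<integral>x. (a + b * x) * indicator {x. (x, h) \<in> A} x \<partial>gauss1)) = 0"
      by (intro DERIV_local_max) auto
    then have "std_normal_density h * ((\<integral>x. (a + b * x) * indicator {x. (x, h) \<in> A \<inter> B} x \<partial>gauss1)
        - \<kappa> * (\<integral>x. (a + b * x) * indicator {x. (x, h) \<in> A} x \<partial>gauss1)) = 0"
      by (simp only: right_diff_distrib mult_minus_right mult.left_commute)
    moreover have "std_normal_density h \<noteq> 0" using normal_density_pos[of 1 0 h] by simp
    ultimately show ?thesis by simp
  qed
  have secm[measurable]: "{x. (x, y) \<in> A} \<in> sets borel" "{x. (x, y) \<in> A \<inter> B} \<in> sets borel" for y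
    using measurable_section(1)[OF mA] measurable_section(1)[OF mC] by simp_all
  have m0: "measure gauss1 {x. (x, h) \<in> A \<inter> B} = \<kappa> * measure gauss1 {x. (x, h) \<in> A}"
    using stationary[of 1 0] by simp
  have m1: "(\<integral>x. x * indicator {x. (x, h) \<in> A \<inter> B} x \<partial>gauss1) = \<kappa> * (\<integral>x. x * indicator {x. (x, h) \<in> A} x \<partial>gauss1)"
    using stationary[of 0 1] by simp

  have section_le: "measure gauss1 {x. (x, y) \<in> A \<inter> B} \<le> \<kappa> * measure gauss1 {x. (x, y) \<in> A}" if "h < y" for y
  proof (cases "J = {}")
    case True
    then have "A = UNIV" by (simp add: A_def slabs_def)
    then show ?thesis
      using section_le_strip[OF B(1,2,3) _ h that \<kappa>] x0 m0 m1 gauss1.prob_space by simp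
  next
    case False
    \<comment> \<open>Another horizontal slab \<open>j\<close> would contain \<open>z0\<close>,
      which is higher than \<open>h\<close>, and hence all of slab \<open>i\<close>; then no point
      of slab \<open>i\<close> could leave slab \<open>j\<close>.\<close>
    have fst_ne: "fst (fst (f j)) \<noteq> 0" if j: "j \<in> J" for j
    proof
      assume 0: "fst (fst (f j)) = 0"
      have sl: "z \<in> slab (f j) \<longleftrightarrow> \<bar>snd z\<bar> * \<bar>snd (fst (f j))\<bar> \<le> snd (f j)" for z
        by (simp add: slab_def inner_prod_def 0 abs_mult)
      obtain z where z: "z \<in> slabs (I - {j}) f" "z \<notin> slab (f j)"
        using out[of j] j by (auto simp: J_def)
      then have "z \<in> slab (f i)" using that I by (auto simp: J_def slabs_def)
      then have "\<bar>snd z\<bar> \<le> \<bar>snd z0\<bar>" using z0 slab_i by auto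
      then have "\<bar>snd z\<bar> * \<bar>snd (fst (f j))\<bar> \<le> \<bar>snd z0\<bar> * \<bar>snd (fst (f j))\<bar>" by (rule mult_right_mono) simp
      moreover have "z0 \<in> slab (f j)" using z0 that by (auto simp: A_def slabs_def)
      ultimately show False using z(2) sl by fastforce
    qed
    define m where "m j = - snd (fst (f j)) / fst (fst (f j))" for j
    define s where "s j = snd (f j) / \<bar>fst (fst (f j))\<bar>" for j
    have mem: "z \<in> slab (f j) \<longleftrightarrow> \<bar>fst z - m j * snd z\<bar> \<le> s j" if "j \<in> J" for j z
      using mem_slab_iff_abscissa[OF fst_ne[OF that], of z "snd (fst (f j))" "snd (f j)"]
      by (simp add: m_def s_def)
    have Aeq: "A = {z. \<forall>j\<in>J. \<bar>fst z - m j * snd z\<bar> \<le> s j}"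
      using mem by (auto simp: A_def slabs_def)
    show ?thesis unfolding Aeq
    proof (rule section_le_polygon[OF B(1,2,3) _ False _ h that _ \<kappa>])
      show "finite J" using I by (simp add: J_def)
      show "(x0, h) \<in> interior ({z. \<forall>j\<in>J. \<bar>fst z - m j * snd z\<bar> \<le> s j} \<inter> B)" using x0 by (simp only: Aeq)
      fix j assume j: "j \<in> J"
      then obtain z where z: "z \<in> B" "z \<in> slabs (I - {j}) f" "z \<notin> slab (f j)"
        using out[of j] j by (auto simp: J_def)
      then have "z \<in> slab (f i)" using j I by (auto simp: J_def slabs_def)
      then show "\<exists>z\<in>B. \<bar>snd z\<bar> \<le> h \<and> s j < \<bar>fst z - m j * snd z\<bar>"
        using z(1,3) unfolding mem[OF j] slab_i by (intro bexI[of _ z]) auto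
    qed (use m0 m1 in \<open>simp_all only: Aeq\<close>)
  qed

  have "V (A \<inter> B) 0 0 0 \<le> \<kappa> * V A 0 0 0"
  proof -
    have V: "V K 0 0 0 = (\<integral>y. measure gauss1 {x. (x, y) \<in> K} * indicator {h<..} y \<partial>gauss1)"
      if [measurable]: "K \<in> sets borel" for K
    proof -
      have m: "K \<inter> {z. h < snd z} \<in> sets borel"
        by (intro sets.Int[OF that] borel_open open_Collect_less continuous_intros)
      show ?thesis unfolding V_def
        using measure_gauss2[OF m] by (auto simp: indicator_def intro!: Bochner_Integration.integral_cong)
    qed
    have int: "integrable gauss1 (\<lambda>y. measure gauss1 {x. (x, y) \<in> K} * indicator {h<..} y)"
      if [measurable]: "K \<in> sets borel" for K
      by (intro gauss1.integrable_const_bound[where B=1]) (auto simp: indicator_def)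
    have "V (A \<inter> B) 0 0 0 \<le> (\<integral>y. \<kappa> * (measure gauss1 {x. (x, y) \<in> A} * indicator {h<..} y) \<partial>gauss1)"
      unfolding V[OF mC] using section_le \<kappa>
      by (intro integral_mono int[OF mC] integrable_mult_right int[OF mA]) (auto simp: indicator_def)
    then show ?thesis unfolding V[OF mA] by simp
  qed
  moreover have "gap B (I - {i}) f = measure gauss2 (A \<inter> B) - \<kappa> * measure gauss2 A"
    by (simp add: gap_def A_def J_def \<kappa>_def)
  ultimately show ?thesis using G[of 0 0 0] h unfolding fid by simp
qed

section \<open>The Gaussian correlation inequality in the plane\<close>

text \<open>The indicators converge off the boundaries of the limit slabs. Such a boundary is a pair
  of null lines or, for normal 0 and nonzero half-width, empty.\<close>

lemma tendsto_measure_slabs: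
  fixes f :: "'i \<Rightarrow> (real \<times> real) \<times> real"
  assumes I: "finite I" and lim: "\<And>i. i \<in> I \<Longrightarrow> (\<lambda>n. X n i) \<longlonglongrightarrow> f i"
    and nz: "\<And>i. i \<in> I \<Longrightarrow> f i \<noteq> 0" and K[measurable]: "K \<in> sets borel"
  shows "(\<lambda>n. measure gauss2 (slabs I (X n) \<inter> K)) \<longlonglongrightarrow> measure gauss2 (slabs I f \<inter> K)"
proof -
  have "(\<lambda>n. \<integral>z. indicator (slabs I (X n) \<inter> K) z \<partial>gauss2) \<longlonglongrightarrow> (\<integral>z. indicator (slabs I f \<inter> K) z \<partial>gauss2 :: real)"
  proof (rule integral_dominated_convergence[where w="\<lambda>_. 1"])
    have "AE z in gauss2. \<bar>z \<bullet> fst (f i)\<bar> \<noteq> snd (f i)" if "i \<in> I" for i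
    proof (cases "fst (f i) = 0")
      case True
      then have "snd (f i) \<noteq> 0" using nz[OF that] by (auto simp: prod_eq_iff)
      then show ?thesis using True by simp
    next
      case False
      have "AE z in gauss2. z \<bullet> fst (f i) \<noteq> t" for t
        by (rule AE_I'[OF gauss2_line_null[OF False, of t]]) auto
      from this[of "snd (f i)"] this[of "- snd (f i)"] show ?thesis
        by eventually_elim auto
    qed
    then have "AE z in gauss2. \<forall>i\<in>I. \<bar>z \<bullet> fst (f i)\<bar> \<noteq> snd (f i)"
      using I by (simp add: AE_finite_all)
    then show "AE z in gauss2. (\<lambda>n. indicator (slabs I (X n) \<inter> K) z) \<longlonglongrightarrow> (indicator (slabs I f \<inter> K) z :: real)"
    proof eventually_elim
      case (elim z)
      have "\<forall>\<^sub>F n in sequentially. z \<in> slab (X n i) \<longleftrightarrow> z \<in> slab (f i)" if i: "i \<in> I" for i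
      proof -
        have "(\<lambda>n. \<bar>z \<bullet> fst (X n i)\<bar> - snd (X n i)) \<longlonglongrightarrow> \<bar>z \<bullet> fst (f i)\<bar> - snd (f i)"
          by (intro tendsto_intros lim i)
        then have "\<forall>\<^sub>F n in sequentially. \<bar>z \<bullet> fst (X n i)\<bar> - snd (X n i) > 0 \<longleftrightarrow> \<bar>z \<bullet> fst (f i)\<bar> - snd (f i) > 0"
          using elim i order_tendstoD[of _ "\<bar>z \<bullet> fst (f i)\<bar> - snd (f i)" sequentially 0]
          by (cases "\<bar>z \<bullet> fst (f i)\<bar> - snd (f i) > 0") (fastforce elim!: eventually_mono)+
        then show ?thesis by (auto simp: slab_def not_less elim!: eventually_mono)
      qed
      then have "\<forall>\<^sub>F n in sequentially. \<forall>i\<in>I. z \<in> slab (X n i) \<longleftrightarrow> z \<in> slab (f i)"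
        using I by (simp add: eventually_ball_finite)
      then have "\<forall>\<^sub>F n in sequentially. indicator (slabs I (X n) \<inter> K) z = (indicator (slabs I f \<inter> K) z :: real)"
        by eventually_elim (auto simp: slabs_def indicator_def)
      then show ?case by (rule tendsto_eventually)
    qed
  qed (auto simp: indicator_def)
  then show ?thesis by simp
qed

text \<open>A product of unit spheres is compact and \<open>gap\<close> is continuous on it.
  Rescaling each parameter then extends minimality to all nonzero parameters.\<close>

lemma gap_minimizer:
  fixes I :: "nat set"
  assumes I: "finite I" and B: "B \<in> sets borel"
  obtains f where "\<And>i. norm (f i) = 1" "\<And>g. (\<And>i. i \<in> I \<Longrightarrow> g i \<noteq> 0) \<Longrightarrow> gap B I f \<le> gap B I g"
proof -
  define F :: "(nat \<Rightarrow> (real \<times> real) \<times> real) set" where "F = PiE UNIV (\<lambda>_. sphere 0 1)"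
  have "compactin (product_topology (\<lambda>_. euclidean) UNIV) F"
    unfolding F_def by (subst compactin_PiE) auto
  then have "compact F" by (simp add: euclidean_product_topology)
  moreover have "(\<lambda>_. ((1, 0), 0)) \<in> F" by (auto simp: F_def norm_Pair)
  moreover have "continuous_on F (gap B I)"
    unfolding continuous_on_sequentially comp_def
  proof safe
    fix X f assume X: "f \<in> F" "X \<longlonglongrightarrow> f"
    have "(\<lambda>n. X n i) \<longlonglongrightarrow> f i" for i
    proof -
      have "continuous_on UNIV (\<lambda>x :: nat \<Rightarrow> (real \<times> real) \<times> real. x i)"
        by (rule continuous_on_product_coordinates)
      then show ?thesis using X(2) unfolding continuous_on_sequentially comp_def by blast
    qed
    moreover have "f i \<noteq> 0" for i using X(1) by (auto simp: F_def PiE_iff dest!: spec[of _ i])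
    ultimately have "(\<lambda>n. measure gauss2 (slabs I (X n) \<inter> K)) \<longlonglongrightarrow> measure gauss2 (slabs I f \<inter> K)"
      if "K \<in> sets borel" for K
      using that by (intro tendsto_measure_slabs I)
    from this[OF B] this[of UNIV] show "(\<lambda>n. gap B I (X n)) \<longlonglongrightarrow> gap B I f"
      unfolding gap_def by (intro tendsto_intros) simp_all
  qed
  ultimately obtain f where f: "f \<in> F" "\<And>g. g \<in> F \<Longrightarrow> gap B I f \<le> gap B I g"
    using continuous_attains_inf[of F "gap B I"] by blast
  show ?thesis
  proof
    show "norm (f i) = 1" for i using f(1) by (auto simp: F_def PiE_iff)
    fix g assume g: "\<And>i. i \<in> I \<Longrightarrow> g i \<noteq> (0 :: (real \<times> real) \<times> real)"
    \<comment> \<open>Unit parameters with the same slabs on \<open>I\<close>; outside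
      \<open>I\<close> any unit vector will do.\<close>
    define g' where "g' i = (if i \<in> I then inverse (norm (g i)) *\<^sub>R g i else ((1, 0), 0))" for i
    have "g' \<in> F" using g by (auto simp: F_def g'_def norm_Pair)
    then have "gap B I f \<le> gap B I g'" by (rule f(2))
    also have "slabs I g' = slabs I g"
      unfolding slabs_def using g by (intro INF_cong refl) (simp add: g'_def slab_scale)
    then have "gap B I g' = gap B I g" by (simp add: gap_def)
    finally show "gap B I f \<le> gap B I g" .
  qed
qed

section \<open>Rotating a slab into horizontal position\<close>

lemma rotate2_slab:
  assumes "c\<^sup>2 + s\<^sup>2 = 1"
  shows "rotate2 c s -` slab (rotate2 c s u, t) = slab (u, t)"
  using inner_rotate2[OF assms] by (auto simp: slab_def)

lemma rotate2_inverse: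
  assumes "c\<^sup>2 + s\<^sup>2 = 1"
  shows "rotate2 c s (rotate2 c (- s) z) = z" "rotate2 c (- s) (rotate2 c s z) = z"
proof -
  have "c * (c * x + s * y) - s * (- s * x + c * y) = (c\<^sup>2 + s\<^sup>2) * x"
    "s * (c * x + s * y) + c * (- s * x + c * y) = (c\<^sup>2 + s\<^sup>2) * y"
    "c * (c * x - s * y) + s * (s * x + c * y) = (c\<^sup>2 + s\<^sup>2) * x"
    "- s * (c * x - s * y) + c * (s * x + c * y) = (c\<^sup>2 + s\<^sup>2) * y" for x y
    by (simp_all add: power2_eq_square algebra_simps)
  then show "rotate2 c s (rotate2 c (- s) z) = z" "rotate2 c (- s) (rotate2 c s z) = z"
    using assms by (simp_all add: rotate2_def)
qed

lemma gap_rotate2: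
  assumes cs: "c\<^sup>2 + s\<^sup>2 = 1" "0 \<le> c" and B: "B \<in> sets borel"
    and g: "\<And>i. i \<in> I \<Longrightarrow> slab (f i) = rotate2 c s -` slab (g i)"
  shows "gap (rotate2 c s -` B) I f = gap B I g"
proof -
  have e: "slabs I f = rotate2 c s -` slabs I g"
    using g by (auto simp: slabs_def)
  show ?thesis unfolding gap_def e vimage_Int[symmetric]
    using B by (simp add: measure_gauss2_rotate2[OF _ cs] del: vimage_Int)
qed

text \<open>Rotation invariance reduces this to \<open>gap_remove_horizontal_slab\<close>;
  minimality transfers because rotated variations are again admissible.\<close>

lemma gap_remove_slab:
  fixes f :: "'i \<Rightarrow> (real \<times> real) \<times> real"
  assumes B: "compact B" "convex B" "\<And>z. z \<in> B \<Longrightarrow> - z \<in> B" "0 \<in> interior B"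
    and I: "finite I" "i \<in> I" and fi: "fst (f i) \<noteq> 0"
    and pos: "\<And>j. j \<in> I \<Longrightarrow> 0 < snd (f j)"
    and out: "\<And>j. j \<in> I \<Longrightarrow> \<exists>z\<in>B \<inter> slabs (I - {j}) f. z \<notin> slab (f j)"
    and min: "\<And>p. p \<noteq> 0 \<Longrightarrow> gap B I f \<le> gap B I (f(i := p))"
  shows "gap B (I - {i}) f \<le> gap B I f"
proof -
  obtain a b where ab: "fst (f i) = (a, b)" by fastforce
  \<comment> \<open>A slab does not change when its normal is negated; this sign makes the cosine
    \<open>c\<close> nonnegative.\<close>
  define \<sigma> :: real where "\<sigma> = (if 0 \<le> b then 1 else - 1)"
  define r where "r = norm (a, b)"
  have r: "0 < r" "r\<^sup>2 = a\<^sup>2 + b\<^sup>2"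
  proof -
    show "0 < r" using fi ab unfolding r_def by simp
    show "r\<^sup>2 = a\<^sup>2 + b\<^sup>2" by (simp add: r_def norm_Pair)
  qed
  define c where "c = \<sigma> * b / r"
  define s where "s = - (\<sigma> * a / r)"
  have \<sigma>: "\<sigma> * \<sigma> = 1" "0 \<le> \<sigma> * b" by (auto simp: \<sigma>_def)
  have cs: "c\<^sup>2 + s\<^sup>2 = 1" "0 \<le> c"
  proof -
    have "c\<^sup>2 + s\<^sup>2 = (\<sigma> * \<sigma>) * (a\<^sup>2 + b\<^sup>2) / r\<^sup>2"
      by (simp add: c_def s_def power2_eq_square add_divide_distrib algebra_simps)
    then show "c\<^sup>2 + s\<^sup>2 = 1" unfolding r(2)[symmetric] \<sigma>(1) using r(1) by simp
    show "0 \<le> c" using r \<sigma> by (simp add: c_def)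
  qed
  text \<open>This rotation carries the vertical unit vector to a multiple of the normal of slab \<open>i\<close>.\<close>
  let ?R = "rotate2 c s" and ?S = "rotate2 c (- s)"
  have e2: "fst (f i) = ?R (0, \<sigma> * r)"
  proof -
    have "- s * (\<sigma> * r) = a" "c * (\<sigma> * r) = b" using r \<sigma>(1) by (simp_all add: c_def s_def mult.assoc)
    then show ?thesis by (simp add: ab rotate2_def)
  qed
  define B' where "B' = ?R -` B"
  \<comment> \<open>Slab \<open>i\<close> gets the exact unit normal \<open>(0, 1)\<close>, so its
    half-width is divided by \<open>r\<close>; the other normals are rotated back.\<close>
  define g where "g j = (if j = i then ((0, 1), snd (f i) / r) else (?S (fst (f j)), snd (f j)))" for j
  have gi: "slab (g i) = slab (r *\<^sub>R g i)" using r by (simp add: slab_scale)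
  have sl: "slab (g j) = ?R -` slab (f j)" for j
  proof (cases "j = i")
    case True
    have "z \<in> slab (r *\<^sub>R g i) \<longleftrightarrow> z \<in> slab ((0, \<sigma> * r), snd (f i))" for z
      using r by (auto simp: slab_def g_def inner_prod_def \<sigma>_def)
    then have "slab (g i) = slab ((0, \<sigma> * r), snd (f i))" unfolding gi by blast
    also have "\<dots> = ?R -` slab (?R (0, \<sigma> * r), snd (f i))" by (simp add: rotate2_slab[OF cs(1)])
    finally show ?thesis using True e2 by (metis prod.collapse)
  next
    case False
    then show ?thesis
      using rotate2_slab[OF cs(1), of "?S (fst (f j))" "snd (f j)"]
      by (simp add: g_def rotate2_inverse[OF cs(1)])
  qed
  have Bb: "B \<in> sets borel" using B(1) by (simp add: borel_compact)
  have gap_eq: "gap B' K g = gap B K f" for K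
    unfolding B'_def by (rule gap_rotate2[OF cs Bb sl])
  have R0: "linear ?R" "linear ?S" by (rule linear_rotate2)+
  have B'_img: "B' = ?S ` B"
    unfolding B'_def using rotate2_inverse[OF cs(1)] by (auto simp: image_iff) (metis)
  have "gap B' (I - {i}) g \<le> gap B' I g"
  proof (rule gap_remove_horizontal_slab[where h="snd (f i) / r"])
    show "compact B'" unfolding B'_img by (intro compact_continuous_image continuous_intros B(1))
    show "convex B'" unfolding B'_img by (intro convex_linear_image R0 B(2))
    show "- z \<in> B'" if "z \<in> B'" for z
      using that B(3)[of "?R z"] by (simp add: B'_def linear_neg[OF R0(1)])
    show "0 \<in> interior B'"
    proof (rule interiorI)
      show "open (?R -` interior B)"
        by (intro open_vimage continuous_intros) simp
      show "0 \<in> ?R -` interior B" using B(4) by (simp add: linear_0[OF R0(1)])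
      show "?R -` interior B \<subseteq> B'" using interior_subset by (auto simp: B'_def)
    qed
    show "g i = ((0, 1), snd (f i) / r)" by (simp add: g_def)
    show "0 < snd (g j)" if "j \<in> I" for j using pos[OF that] r by (auto simp: g_def)
    show "\<exists>z\<in>B' \<inter> slabs (I - {j}) g. z \<notin> slab (g j)" if j: "j \<in> I" for j
    proof -
      obtain z where z: "z \<in> B" "z \<in> slabs (I - {j}) f" "z \<notin> slab (f j)" using out[OF j] by blast
      then show ?thesis
        by (intro bexI[of _ "?S z"]) (auto simp: slabs_def sl B'_def rotate2_inverse[OF cs(1)])
    qed
    fix p :: "(real \<times> real) \<times> real" assume "p \<noteq> 0"
    define p' where "p' = (?R (fst p), snd p)"
    have "p' \<noteq> 0"
    proof
      assume "p' = 0"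
      then have R: "?R (fst p) = 0" "snd p = 0" by (simp_all add: p'_def zero_prod_def)
      have "fst p = ?S (?R (fst p))" by (simp add: rotate2_inverse[OF cs(1)])
      also have "\<dots> = 0" unfolding R(1) by (rule linear_0[OF R0(2)])
      finally show False using \<open>p \<noteq> 0\<close> R(2) by (metis prod.collapse zero_prod_def)
    qed
    have "slab ((g(i := p)) j) = ?R -` slab ((f(i := p')) j)" for j
      using rotate2_slab[OF cs(1), of "fst p" "snd p"] sl by (simp add: p'_def)
    then have "gap B' I (g(i := p)) = gap B I (f(i := p'))"
      unfolding B'_def by (rule gap_rotate2[OF cs Bb])
    then show "gap B' I g \<le> gap B' I (g(i := p))"
      unfolding gap_eq using min[OF \<open>p' \<noteq> 0\<close>] by simp
  qed (use I in auto)
  then show ?thesis unfolding gap_eq .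
qed

text \<open>Induction on the set of slabs: at a minimiser with negative value no slab could be
  dropped without raising \<open>gap\<close>, contrary to \<open>gap_remove_slab\<close>.\<close>

lemma gap_nonneg:
  fixes I :: "nat set"
  assumes B: "compact B" "convex B" "\<And>z. z \<in> B \<Longrightarrow> - z \<in> B" "0 \<in> interior B"
  shows "finite I \<Longrightarrow> (\<And>i. f i \<noteq> 0) \<Longrightarrow> 0 \<le> gap B I f"
proof (induction I arbitrary: f rule: finite_psubset_induct)
  case (psubset I)
  have Bb[measurable]: "B \<in> sets borel" using B(1) by (simp add: borel_compact)
  let ?\<kappa> = "measure gauss2 B"
  obtain f0 where f0: "\<And>i. norm (f0 i) = 1" and min: "\<And>g. (\<And>i. i \<in> I \<Longrightarrow> g i \<noteq> 0) \<Longrightarrow> gap B I f0 \<le> gap B I g"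
    using gap_minimizer[OF psubset.hyps Bb] by blast
  have f0_nz: "f0 i \<noteq> 0" for i using f0[of i] by auto
  have "0 \<le> gap B I f0"
  proof (rule ccontr)
    assume "\<not> ?thesis"
    then have neg: "gap B I f0 < 0" by simp
    have less: "gap B I f0 < gap B (I - {j}) f0" if "j \<in> I" for j
      using psubset.IH[of "I - {j}" f0] f0_nz that neg by fastforce
    have "I \<noteq> {}" using neg gauss2.prob_space by (auto simp: gap_def slabs_def)
    then obtain i where i: "i \<in> I" by blast
    \<comment> \<open>If slab \<open>j\<close> cut nothing off inside \<open>B\<close>, dropping it
      would keep the intersection with \<open>B\<close> and only enlarge the subtracted
      term.\<close>
    have out: "\<exists>z\<in>B \<inter> slabs (I - {j}) f0. z \<notin> slab (f0 j)" if j: "j \<in> I" for j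
    proof (rule ccontr)
      assume "\<not> ?thesis"
      then have "slabs (I - {j}) f0 \<inter> B = slabs I f0 \<inter> B" using slabs_remove[OF j, of f0] by blast
      moreover have "measure gauss2 (slabs I f0) \<le> measure gauss2 (slabs (I - {j}) f0)"
        using slabs_remove[OF j, of f0] by (intro gauss2.finite_measure_mono) auto
      ultimately have "gap B (I - {j}) f0 \<le> gap B I f0"
        by (simp add: gap_def mult_left_mono)
      then show False using less[OF j] by simp
    qed
    \<comment> \<open>Degenerate slabs are ruled out: an empty set or a line would give the
      intersection measure 0 and so a nonnegative gap, and the whole plane cuts nothing off.\<close>
    have fst_nz: "fst (f0 j) \<noteq> 0" and pos: "0 < snd (f0 j)" if j: "j \<in> I" for j
    proof -
      have ne: "slabs I f0 \<noteq> {}" "measure gauss2 (slabs I f0) \<noteq> 0"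
      proof -
        show "measure gauss2 (slabs I f0) \<noteq> 0"
          using neg measure_nonneg[of gauss2 "slabs I f0 \<inter> B"] by (auto simp: gap_def)
        then show "slabs I f0 \<noteq> {}" by auto
      qed
      then have snd_nn: "0 \<le> snd (f0 j)" using j by (force simp: slabs_def slab_def)
      show fst_nz: "fst (f0 j) \<noteq> 0"
      proof
        assume "fst (f0 j) = 0"
        then have "slab (f0 j) = UNIV" using snd_nn by (auto simp: slab_def)
        then show False using out[OF j] by auto
      qed
      show "0 < snd (f0 j)"
      proof (rule ccontr)
        assume "\<not> 0 < snd (f0 j)"
        then have "slab (f0 j) \<subseteq> {z. z \<bullet> fst (f0 j) = 0}" by (auto simp: slab_def)
        then have "slabs I f0 \<subseteq> {z. z \<bullet> fst (f0 j) = 0}" using j by (auto simp: slabs_def)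
        then have "measure gauss2 (slabs I f0) \<le> measure gauss2 {z. z \<bullet> fst (f0 j) = 0}"
          using gauss2_line_null[OF fst_nz, of 0] by (intro gauss2.finite_measure_mono) auto
        also have "\<dots> = 0" using null_setsD1[OF gauss2_line_null[OF fst_nz, of 0]] by (simp add: measure_def)
        finally show False using ne(2) measure_nonneg[of gauss2 "slabs I f0"] by linarith
      qed
    qed
    have "gap B (I - {i}) f0 \<le> gap B I f0"
      using f0_nz by (intro gap_remove_slab[OF B psubset.hyps i fst_nz[OF i] pos out] min) auto
    then show False using less[OF i] by simp
  qed
  also have "gap B I f0 \<le> gap B I f" by (rule min) (use psubset.prems in auto)
  finally show ?case .
qed

text \<open>A hyperplane separating an outside point from \<open>K\<close>, together with its
  reflection, bounds a slab around \<open>K\<close>. Lindelof's theorem reduces these slabs to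
  countably many.\<close>

lemma symmetric_convex_eq_slabs:
  fixes K :: "(real \<times> real) set"
  assumes "closed K" "convex K" and sym: "\<And>z. z \<in> K \<Longrightarrow> - z \<in> K"
  obtains f :: "nat \<Rightarrow> (real \<times> real) \<times> real" where "\<And>i. f i \<noteq> 0" "K = slabs UNIV f"
proof -
  define P where "P = {p. p \<noteq> 0 \<and> K \<subseteq> slab p}"
  have sep: "\<exists>p\<in>P. x \<notin> slab p" if x: "x \<notin> K" for x
  proof -
    obtain a b where ab: "a \<bullet> x < b" "\<And>z. z \<in> K \<Longrightarrow> b < a \<bullet> z"
      using separating_hyperplane_closed_point[OF assms(2,1) x] by blast
    show ?thesis
    proof (cases "K = {}")
      case True
      \<comment> \<open>A negative half-width makes the slab empty.\<close>
      then show ?thesis by (intro bexI[of _ "(0, - 1)"]) (auto simp: P_def slab_def prod_eq_iff)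
    next
      case False
      then obtain z where z: "z \<in> K" by blast
      have "b < a \<bullet> z" "b < - (a \<bullet> z)" using ab(2)[OF z] ab(2)[OF sym[OF z]] by auto
      then have "b < 0" by linarith
      have "K \<subseteq> slab (a, - b)"
      proof
        fix z assume z: "z \<in> K"
        have "b < a \<bullet> z" "b < - (a \<bullet> z)" using ab(2)[OF z] ab(2)[OF sym[OF z]] by auto
        then show "z \<in> slab (a, - b)" by (simp add: slab_def abs_le_iff inner_commute)
      qed
      moreover have "x \<notin> slab (a, - b)" using ab(1) by (auto simp: slab_def abs_le_iff inner_commute)
      ultimately show ?thesis using \<open>b < 0\<close> by (intro bexI[of _ "(a, - b)"]) (auto simp: P_def zero_prod_def)
    qed
  qed
  obtain F where F: "F \<subseteq> (\<lambda>p. - slab p) ` P" "countable F" "\<Union>F = \<Union>((\<lambda>p. - slab p) ` P)"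
    using Lindelof[of "(\<lambda>p. - slab p) ` P"] closed_slab by blast
  then obtain Q where Q: "Q \<subseteq> P" "countable Q" "F = (\<lambda>p. - slab p) ` Q"
    by (meson countable_subset_image)
  \<comment> \<open>Adding the parameter of the whole plane makes the family nonempty, so that the
    natural numbers enumerate it.\<close>
  define Q' where "Q' = insert (0, 1) Q"
  have Q': "Q' \<noteq> {}" "countable Q'" using Q by (auto simp: Q'_def)
  have range: "range (from_nat_into Q') = Q'" using Q' by (rule range_from_nat_into)
  have "K = (\<Inter>p\<in>Q'. slab p)"
  proof
    have "slab (0, 1) = UNIV" by (auto simp: slab_def)
    then show "K \<subseteq> (\<Inter>p\<in>Q'. slab p)" using Q(1) by (auto simp: Q'_def P_def)
    show "(\<Inter>p\<in>Q'. slab p) \<subseteq> K"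
    proof (rule ccontr)
      assume "\<not> ?thesis"
      then obtain x where x: "x \<in> (\<Inter>p\<in>Q'. slab p)" "x \<notin> K" by blast
      then have "x \<in> \<Union>F" unfolding F(3) using sep by blast
      then show False using x(1) unfolding Q(3) by (auto simp: Q'_def)
    qed
  qed
  also have "\<dots> = slabs UNIV (from_nat_into Q')"
    unfolding slabs_def by (subst range[symmetric]) simp
  finally have "K = slabs UNIV (from_nat_into Q')" .
  moreover have "from_nat_into Q' i \<noteq> 0" for i
    using from_nat_into[OF Q'(1), of i] Q(1) by (auto simp: Q'_def P_def prod_eq_iff)
  ultimately show ?thesis using that by blast
qed

text \<open>\<open>A\<close> is the decreasing limit of finite intersections of slabs, to which
  \<open>gap_nonneg\<close> applies; continuity from above passes to the limit.\<close>

theorem gaussian_correlation_plane: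
  fixes A B :: "(real \<times> real) set"
  assumes A: "closed A" "convex A" "\<And>z. z \<in> A \<Longrightarrow> - z \<in> A"
    and B: "compact B" "convex B" "\<And>z. z \<in> B \<Longrightarrow> - z \<in> B" "0 \<in> interior B"
  shows "measure gauss2 A * measure gauss2 B \<le> measure gauss2 (A \<inter> B)"
proof -
  have Bb[measurable]: "B \<in> sets borel" using B(1) by (simp add: borel_compact)
  obtain f :: "nat \<Rightarrow> (real \<times> real) \<times> real" where f: "\<And>i. f i \<noteq> 0" "A = slabs UNIV f"
    using symmetric_convex_eq_slabs[OF A] by blast
  define S where "S n = slabs {..<n} f" for n
  have lim: "(\<lambda>n. measure gauss2 (S n \<inter> K)) \<longlonglongrightarrow> measure gauss2 (A \<inter> K)" if [measurable]: "K \<in> sets borel" for K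
  proof -
    have "(\<Inter>n. S n \<inter> K) = A \<inter> K" by (auto simp: S_def slabs_def f(2) lessThan_Suc_eq_insert_0)
    moreover have "(\<lambda>n. measure gauss2 (S n \<inter> K)) \<longlonglongrightarrow> measure gauss2 (\<Inter>n. S n \<inter> K)"
    proof (rule gauss2.finite_Lim_measure_decseq)
      show "range (\<lambda>n. S n \<inter> K) \<subseteq> sets gauss2" by (auto simp: S_def)
      show "decseq (\<lambda>n. S n \<inter> K)" by (auto simp: S_def slabs_def decseq_def)
    qed
    ultimately show ?thesis by simp
  qed
  have "measure gauss2 (S n) * measure gauss2 B \<le> measure gauss2 (S n \<inter> B)" for n
    using gap_nonneg[OF B, of "{..<n}" f] f(1) by (simp add: gap_def S_def mult.commute)
  then show ?thesis
    using lim[OF Bb] lim[of UNIV]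
    by (intro LIMSEQ_le[OF tendsto_mult_right]) auto
qed

section \<open>Comparison with strips\<close>

text \<open>The origin is the midpoint of an interior point and its negative.\<close>

lemma zero_in_interior_symmetric:
  fixes K :: "'a :: euclidean_space set"
  assumes "convex K" "interior K \<noteq> {}" and sym: "\<And>z. z \<in> K \<Longrightarrow> - z \<in> K"
  shows "0 \<in> interior K"
proof -
  obtain z where z: "z \<in> interior K" using assms(2) by blast
  have "- z \<in> closure K" using z interior_subset closure_subset sym by blast
  show ?thesis
  proof (cases "z = 0")
    case False
    then have "z \<noteq> - z" by (metis add.right_inverse scaleR_2 scaleR_eq_0_iff zero_neq_numeral)
    then have "midpoint z (- z) \<in> open_segment z (- z)" by simp
    then have "0 \<in> open_segment z (- z)" by (simp add: midpoint_def)
    then show ?thesis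
      using in_interior_closure_convex_segment[OF assms(1) z \<open>- z \<in> closure K\<close>] by blast
  qed (use z in simp)
qed

section \<open>The measures \<open>mu2 n\<close> and their density\<close>

definition mu2_density :: "nat \<Rightarrow> real \<times> real \<Rightarrow> real" where
  "mu2_density n z = Cn n * \<bar>snd z\<bar> ^ (n - 1) * exp (- ((fst z)\<^sup>2 + (snd z)\<^sup>2) / 2)"

lemma measurable_mu2_density [measurable]: "mu2_density n \<in> borel_measurable borel"
  unfolding mu2_density_def by (intro borel_measurable_continuous_onI continuous_intros) auto

lemma mu2_eq: "mu2 n = density lborel (\<lambda>z. ennreal (mu2_density n z))"
  by (simp add: mu2_def mu2_density_def case_prod_beta')

lemma sets_mu2 [simp, measurable_cong]: "sets (mu2 n) = sets borel"
  by (simp add: mu2_eq)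

lemma emeasure_mu2:
  "X \<in> sets borel \<Longrightarrow> emeasure (mu2 n) X = (\<integral>\<^sup>+z. ennreal (mu2_density n z) * indicator X z \<partial>lborel)"
  unfolding mu2_eq by (subst emeasure_density) auto

lemma emeasure_mu2_le:
  assumes [measurable]: "X \<in> sets borel" and "0 \<le> c" "\<And>z. z \<in> X \<Longrightarrow> mu2_density n z \<le> c"
  shows "emeasure (mu2 n) X \<le> ennreal c * emeasure lborel X"
proof -
  have "emeasure (mu2 n) X \<le> (\<integral>\<^sup>+z. ennreal c * indicator X z \<partial>lborel)"
    unfolding emeasure_mu2[OF assms(1)]
    using assms by (intro nn_integral_mono) (auto simp: indicator_def ennreal_leI)
  then show ?thesis by (simp add: nn_integral_cmult_indicator)
qed

lemma emeasure_mu2_ge: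
  assumes [measurable]: "X \<in> sets borel" and "\<And>z. z \<in> X \<Longrightarrow> c \<le> mu2_density n z"
  shows "ennreal c * emeasure lborel X \<le> emeasure (mu2 n) X"
proof -
  have "(\<integral>\<^sup>+z. ennreal c * indicator X z \<partial>lborel) \<le> emeasure (mu2 n) X"
    unfolding emeasure_mu2[OF assms(1)]
    using assms by (intro nn_integral_mono) (auto simp: indicator_def ennreal_leI)
  then show ?thesis by (simp add: nn_integral_cmult_indicator)
qed

text \<open>The continuous density is bounded on \<open>K\<close>, hence finiteness; it can vanish
  only on the horizontal axis, a null set, hence positivity.\<close>

lemma measure_mu2_pos:
  assumes "0 < Cn n" "compact K" "interior K \<noteq> {}"
  shows "emeasure (mu2 n) K < \<infinity>" "0 < measure (mu2 n) K"
proof -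
  have [measurable]: "K \<in> sets borel" using assms(2) by (rule borel_compact)
  have "bounded (mu2_density n ` K)"
    unfolding mu2_density_def by (intro compact_imp_bounded compact_continuous_image continuous_intros assms(2)) auto
  then obtain c where c: "\<And>z. z \<in> K \<Longrightarrow> mu2_density n z \<le> c" "0 < c"
    by (force simp: bounded_pos abs_le_iff)
  have "emeasure (mu2 n) K \<le> ennreal c * emeasure lborel K"
    using c by (intro emeasure_mu2_le) auto
  also have "\<dots> < \<infinity>"
    using emeasure_bounded_finite[OF compact_imp_bounded[OF assms(2)]] by (simp add: ennreal_mult_less_top)
  finally show fin: "emeasure (mu2 n) K < \<infinity>" .
  have "emeasure (mu2 n) K \<noteq> 0"
  proof
    assume "emeasure (mu2 n) K = 0"
    then have "AE z in lborel. ennreal (mu2_density n z) * indicator K z = 0"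
      by (subst (asm) emeasure_mu2, simp, subst (asm) nn_integral_0_iff_AE) auto
    moreover have "AE z in lborel :: (real \<times> real) measure. z \<bullet> (0, 1) \<noteq> 0"
    proof (rule AE_I')
      have "closed {z :: real \<times> real. z \<bullet> (0, 1) = 0}" by (intro closed_Collect_eq continuous_intros)
      moreover have "negligible {z :: real \<times> real. (0, 1) \<bullet> z = 0}"
        by (rule negligible_hyperplane) (simp add: zero_prod_def)
      ultimately show "{z :: real \<times> real. z \<bullet> (0, 1) = 0} \<in> null_sets lborel"
        by (auto simp: negligible_iff_null_sets inner_commute null_sets_def intro: borel_closed)
    qed auto
    ultimately have "AE z in lborel. z \<notin> K"
    proof eventually_elim
      case (elim z)
      then have "0 < mu2_density n z" using assms(1) by (simp add: mu2_density_def inner_prod_def)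
      then show ?case using elim by (auto simp: ennreal_eq_0_iff)
    qed
    then have "emeasure lborel K = 0"
      using AE_iff_null_sets[of K lborel] by (auto simp: null_sets_def)
    then show False using emeasure_lborel_interior_nonempty[OF assms(3)] by simp
  qed
  then show "0 < measure (mu2 n) K"
    using fin by (simp add: measure_def enn2real_positive_iff zero_less_iff_neq_zero)
qed

text \<open>For exponent 0 the factor in \<open>y\<close> is 1, leaving a multiple of the Gaussian
  density.\<close>

lemma measure_mu2_one:
  assumes [measurable]: "X \<in> sets borel" and "0 \<le> Cn 1"
  shows "measure (mu2 1) X = 2 * pi * Cn 1 * measure gauss2 X"
proof -
  have e: "ennreal (mu2_density 1 z) = ennreal (2 * pi * Cn 1) * ennreal (exp (- (norm z)\<^sup>2 / 2) / (2 * pi))" for z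
  proof -
    have "(norm z)\<^sup>2 = (fst z)\<^sup>2 + (snd z)\<^sup>2" by (cases z) (simp add: norm_Pair)
    then show ?thesis using assms(2) by (subst ennreal_mult'[symmetric]) (simp_all add: mu2_density_def)
  qed
  have "emeasure (mu2 1) X = (\<integral>\<^sup>+z. ennreal (2 * pi * Cn 1) * (ennreal (exp (- (norm z)\<^sup>2 / 2) / (2 * pi)) * indicator X z) \<partial>lborel)"
    unfolding emeasure_mu2[OF assms(1)] e mult.assoc ..
  also have "\<dots> = ennreal (2 * pi * Cn 1) * emeasure gauss2 X"
    unfolding gauss2_density by (subst nn_integral_cmult) (auto simp: emeasure_density)
  finally show ?thesis using assms(2) by (simp add: measure_def enn2real_mult)
qed

lemma strip_borel: "is_strip S \<Longrightarrow> S \<in> sets borel"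
  by (auto simp: is_strip_def intro!: borel_open open_Collect_less continuous_intros)

lemma measure_mu2_eq_0:
  assumes "Cn n \<le> 0"
  shows "measure (mu2 n) X = 0"
proof -
  have "mu2_density n z \<le> 0" for z using assms by (simp add: mu2_density_def mult_nonpos_nonneg)
  then have "mu2 n = density lborel (\<lambda>_. 0)" unfolding mu2_eq by (simp add: ennreal_neg)
  then have "emeasure (mu2 n) X = 0" if "X \<in> sets borel"
    using that by (simp add: emeasure_density)
  moreover have "emeasure (mu2 n) X = 0" if "X \<notin> sets borel"
    using that by (intro emeasure_notin_sets) simp
  ultimately show ?thesis unfolding measure_def by force
qed

lemma convex_body_compact: "convex_body K \<Longrightarrow> compact K"
  and convex_body_convex: "convex_body K \<Longrightarrow> convex K"
  by (auto simp: convex_body_def)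

lemma convex_body_zero_interior:
  "convex_body K \<Longrightarrow> centrally_symmetric K \<Longrightarrow> 0 \<in> interior K"
  by (intro zero_in_interior_symmetric) (auto simp: convex_body_def centrally_symmetric_def)

text \<open>The strips cross at the origin, where the density vanishes: their intersection has
  measure \<open>O(h^3)\<close>, while each strip keeps measure of order \<open>h\<close> far from
  the axis.\<close>

lemma thin_strips_ratio_small:
  assumes n: "2 \<le> n" and C: "0 < Cn n" and "0 < \<epsilon>"
  shows "\<exists>S1 S2. is_strip S1 \<and> is_strip S2 \<and>
    measure (mu2 n) (S1 \<inter> S2) / (measure (mu2 n) S1 * measure (mu2 n) S2) \<le> \<epsilon>"
proof -
  \<comment> \<open>Lower bound for the density on \<open>{-3..3} \<times> {1..2}\<close>, where the
    squared norm is at most 9 + 4 = 13.\<close>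
  define d where "d = Cn n * exp (- 13 / 2)"
  \<comment> \<open>The first bound gives \<open>2 * h \<le> 1\<close>, so powers of
    \<open>2 * h\<close> are at most \<open>2 * h\<close>; the second makes
    \<open>16 * Cn n * h ^ 3\<close> at most \<open>\<epsilon>\<close> times the square of
    \<open>2 * d * h\<close>.\<close>
  define h where "h = min (1 / 2) (\<epsilon> * d\<^sup>2 / (4 * Cn n))"
  have d: "0 < d" using C by (simp add: d_def)
  have h: "0 < h" "h \<le> 1 / 2" "4 * Cn n * h \<le> \<epsilon> * d\<^sup>2"
  proof -
    show "0 < h" using C d \<open>0 < \<epsilon>\<close> by (simp add: h_def)
    have "h \<le> \<epsilon> * d\<^sup>2 / (4 * Cn n)" by (simp add: h_def)
    then show "4 * Cn n * h \<le> \<epsilon> * d\<^sup>2" using C by (simp add: le_divide_eq mult.commute)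
  qed (simp add: h_def)
  define S1 :: "(real \<times> real) set" where "S1 = {z. \<bar>fst z\<bar> < h}"
  define S2 :: "(real \<times> real) set" where "S2 = {z. \<bar>fst z + snd z\<bar> < h}"
  have st: "is_strip S1" "is_strip S2"
  proof -
    have "S1 = {z. \<bar>z \<bullet> (1, 0)\<bar> < h}" by (auto simp: S1_def inner_prod_def)
    then show "is_strip S1" unfolding is_strip_def using h(1)
      by (intro exI[of _ "(1, 0)"] exI[of _ h]) (auto simp: norm_Pair)
    have "z \<bullet> (1 / sqrt 2, 1 / sqrt 2) = (fst z + snd z) / sqrt 2" for z
      by (cases z) (simp add: add_divide_distrib)
    then have "S2 = {z. \<bar>z \<bullet> (1 / sqrt 2, 1 / sqrt 2)\<bar> < h / sqrt 2}"
      by (auto simp: S2_def abs_divide divide_less_cancel)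
    then show "is_strip S2" unfolding is_strip_def using h(1)
      by (intro exI[of _ "(1 / sqrt 2, 1 / sqrt 2)"] exI[of _ "h / sqrt 2"]) (auto simp: norm_Pair power_divide)
  qed
  have [measurable]: "S1 \<in> sets borel" "S2 \<in> sets borel" using st strip_borel by auto
  have up: "measure (mu2 n) (S1 \<inter> S2) \<le> 16 * Cn n * h ^ 3"
  proof -
    let ?Q = "cbox (- h, - (2 * h)) (h, 2 * h)"
    have sub: "S1 \<inter> S2 \<subseteq> ?Q" by (auto simp: S1_def S2_def abs_if split: if_splits)
    have dens: "mu2_density n z \<le> Cn n * (2 * h)" if "z \<in> ?Q" for z
    proof -
      have y: "\<bar>snd z\<bar> \<le> 2 * h" using that by (cases z) auto
      have "\<bar>snd z\<bar> ^ (n - 1) \<le> (2 * h) ^ (n - 1)" using y by (intro power_mono) auto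
      also have "\<dots> \<le> (2 * h) ^ 1" using h n by (intro power_decreasing) auto
      finally have "\<bar>snd z\<bar> ^ (n - 1) \<le> 2 * h" by simp
      then have "\<bar>snd z\<bar> ^ (n - 1) * exp (- ((fst z)\<^sup>2 + (snd z)\<^sup>2) / 2) \<le> (2 * h) * 1"
        using h(1) by (intro mult_mono) auto
      then show ?thesis unfolding mu2_density_def mult.assoc using C by (intro mult_left_mono) auto
    qed
    have vol: "emeasure lborel ?Q = ennreal (8 * h\<^sup>2)"
      using h(1) by (subst emeasure_lborel_cbox_eq) (auto simp: Basis_prod_def power2_eq_square)
    have "emeasure (mu2 n) (S1 \<inter> S2) \<le> emeasure (mu2 n) ?Q" using sub by (intro emeasure_mono) auto
    also have "\<dots> \<le> ennreal (Cn n * (2 * h)) * ennreal (8 * h\<^sup>2)"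
      unfolding vol[symmetric] using dens C h(1) by (intro emeasure_mu2_le) auto
    also have "\<dots> = ennreal (16 * Cn n * h ^ 3)"
      using C h(1) by (simp add: ennreal_mult'[symmetric] power2_eq_square power3_eq_cube mult_ac)
    finally show ?thesis unfolding measure_def using C h(1) by (intro enn2real_leI) auto
  qed
  define P :: "(real \<times> real) set" where "P = {-h<..<h} \<times> {1..2}"
  have P[measurable]: "P \<in> sets borel" unfolding P_def by (intro borel_Times) auto
  have volP: "emeasure lborel P = ennreal (2 * h)"
    unfolding P_def lborel_prod[symmetric] using h(1)
    by (subst lborel.emeasure_pair_measure_Times) (auto simp: ennreal_mult'[symmetric])
  have low: "2 * d * h \<le> measure (mu2 n) S" if S: "S \<in> sets borel" "X \<in> sets borel" "X \<subseteq> S" "X \<subseteq> {-3..3} \<times> {1..2}"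
    "emeasure lborel X = ennreal (2 * h)" "measure (mu2 n) S \<noteq> 0" for S X
  proof -
    have dens: "d \<le> mu2_density n z" if "z \<in> X" for z
    proof -
      have z: "\<bar>fst z\<bar> \<le> 3" "1 \<le> snd z" "snd z \<le> 2" using S(4) that by force+
      have "(fst z)\<^sup>2 \<le> 3\<^sup>2" "(snd z)\<^sup>2 \<le> 2\<^sup>2"
        using z power_mono[of "\<bar>fst z\<bar>" 3 2] power_mono[of "snd z" 2 2] by simp_all
      then have "exp (- 13 / 2) \<le> exp (- ((fst z)\<^sup>2 + (snd z)\<^sup>2) / 2)" by simp
      moreover have "1 \<le> \<bar>snd z\<bar> ^ (n - 1)" using z by (intro one_le_power) auto
      ultimately have "1 * exp (- 13 / 2) \<le> \<bar>snd z\<bar> ^ (n - 1) * exp (- ((fst z)\<^sup>2 + (snd z)\<^sup>2) / 2)"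
        by (intro mult_mono) auto
      then show ?thesis unfolding mu2_density_def d_def mult.assoc using C by (intro mult_left_mono) auto
    qed
    \<comment> \<open>\<open>measure\<close> sends an infinite value to 0, so a nonzero measure is
      finite.\<close>
    have fin: "emeasure (mu2 n) S \<noteq> \<infinity>" using S(6) by (auto simp: measure_def)
    have "ennreal (2 * d * h) = ennreal d * emeasure lborel X"
      unfolding S(5) using d h(1) by (simp add: ennreal_mult'[symmetric] mult_ac)
    also have "\<dots> \<le> emeasure (mu2 n) X" using S(2) dens by (intro emeasure_mu2_ge) auto
    also have "\<dots> \<le> emeasure (mu2 n) S" using S by (intro emeasure_mono) auto
    also have "\<dots> = ennreal (measure (mu2 n) S)" using fin by (simp add: emeasure_eq_ennreal_measure)
    finally show ?thesis by (simp add: ennreal_le_iff)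
  qed
  show ?thesis
  \<comment> \<open>If a denominator is 0 as a real number, the quotient is 0 by convention.\<close>
  proof (cases "measure (mu2 n) S1 = 0 \<or> measure (mu2 n) S2 = 0")
    case True
    then show ?thesis using st \<open>0 < \<epsilon>\<close> by (intro exI[of _ S1] exI[of _ S2]) auto
  next
    case False
    have l1: "2 * d * h \<le> measure (mu2 n) S1"
    proof (rule low[OF _ P _ _ volP])
      show "P \<subseteq> S1" "P \<subseteq> {-3..3} \<times> {1..2}" using h by (auto simp: P_def S1_def)
    qed (use False in auto)
    \<comment> \<open>A sheared copy of \<open>P\<close> inside \<open>S2\<close> with the same
      area; its abscissae lie between \<open>- h - 2\<close> and \<open>h - 1\<close>.\<close>
    let ?X = "{z. (fst z + 1 * snd z, snd z) \<in> P}"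
    have X[measurable]: "?X \<in> sets borel"
    proof -
      have "(\<lambda>z. (fst z + 1 * snd z, snd z)) -` P \<inter> space borel \<in> sets (borel :: (real \<times> real) measure)"
        by (rule measurable_sets[OF _ P]) (intro borel_measurable_continuous_onI continuous_intros)
      then show ?thesis by (simp add: vimage_def)
    qed
    have "emeasure lborel ?X = (\<integral>\<^sup>+z. indicator P (fst z + 1 * snd z, snd z) \<partial>lborel)"
    proof -
      have "emeasure lborel ?X = (\<integral>\<^sup>+z. indicator ?X z \<partial>lborel)"
        by (rule nn_integral_indicator[symmetric]) (use X in simp)
      also have "\<dots> = (\<integral>\<^sup>+z. indicator P (fst z + 1 * snd z, snd z) \<partial>lborel)"
        by (rule nn_integral_cong) (simp add: indicator_def)
      finally show ?thesis .
    qed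
    also have "\<dots> = ennreal (2 * h)"
      by (subst nn_integral_shear_fst) (auto simp: volP)
    finally have volX: "emeasure lborel ?X = ennreal (2 * h)" .
    have l2: "2 * d * h \<le> measure (mu2 n) S2"
    proof (rule low[OF _ X _ _ volX])
      show "?X \<subseteq> S2" "?X \<subseteq> {-3..3} \<times> {1..2}" using h by (auto simp: P_def S2_def)
    qed (use False in auto)
    have pos: "0 < 2 * d * h" using d h by simp
    have "measure (mu2 n) (S1 \<inter> S2) \<le> 16 * Cn n * h ^ 3" by (rule up)
    also have "\<dots> = (4 * Cn n * h) * (4 * h\<^sup>2)" by (simp add: power2_eq_square power3_eq_cube)
    also have "\<dots> \<le> (\<epsilon> * d\<^sup>2) * (4 * h\<^sup>2)" using h(3) by (intro mult_right_mono) auto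
    also have "\<dots> = \<epsilon> * ((2 * d * h) * (2 * d * h))" by (simp add: power2_eq_square)
    also have "\<dots> \<le> \<epsilon> * (measure (mu2 n) S1 * measure (mu2 n) S2)"
      using \<open>0 < \<epsilon>\<close> l1 l2 pos by (intro mult_left_mono mult_mono) auto
    finally have "measure (mu2 n) (S1 \<inter> S2) / (measure (mu2 n) S1 * measure (mu2 n) S2) \<le> \<epsilon>"
      using l1 l2 pos by (simp add: divide_le_eq)
    then show ?thesis using st by blast
  qed
qed

text \<open>Equality case of the correlation inequality, from the product structure; it provides the
  strips for \<open>n = 1\<close>.\<close>

lemma coordinate_strips_independent:
  defines "S1 \<equiv> {z :: real \<times> real. \<bar>z \<bullet> (1, 0)\<bar> < 1}" and "S2 \<equiv> {z :: real \<times> real. \<bar>z \<bullet> (0, 1)\<bar> < 1}"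
  shows "measure gauss2 (S1 \<inter> S2) = measure gauss2 S1 * measure gauss2 S2"
proof -
  let ?I = "{-1<..<1} :: real set"
  have e: "S1 = ?I \<times> UNIV" "S2 = UNIV \<times> ?I" "S1 \<inter> S2 = ?I \<times> ?I"
    by (auto simp: S1_def S2_def)
  have t: "measure gauss2 (A \<times> B) = measure gauss1 A * measure gauss1 B"
    if "A \<in> sets borel" "B \<in> sets borel" for A B
    unfolding gauss2_def measure_def using that
    by (subst gauss1.emeasure_pair_measure_Times) (auto simp: enn2real_mult)
  show ?thesis unfolding e(3) unfolding e(1,2)
    using gauss1.prob_space by (simp add: t)
qed

theorem theorem2:
  fixes n :: nat and K1 K2 :: "(real \<times> real) set"
  assumes "n \<ge> 1"
    and "convex_body K1" "centrally_symmetric K1"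
    and "convex_body K2" "centrally_symmetric K2"
  shows "\<exists>S1 S2. is_strip S1 \<and> is_strip S2 \<and>
    measure (mu2 n) (K1 \<inter> K2) / (measure (mu2 n) K1 * measure (mu2 n) K2)
      \<ge> measure (mu2 n) (S1 \<inter> S2) / (measure (mu2 n) S1 * measure (mu2 n) S2)"
proof -
  define T1 T2 :: "(real \<times> real) set" where "T1 = {z. \<bar>z \<bullet> (1, 0)\<bar> < 1}" and "T2 = {z. \<bar>z \<bullet> (0, 1)\<bar> < 1}"
  have T: "is_strip T1" "is_strip T2"
    unfolding is_strip_def T1_def T2_def
    by (intro exI[of _ "(1, 0)"] exI[of _ "(0, 1)"] exI[of _ 1]; simp add: norm_Pair)+
  have cp: "compact K1" "compact K2" using assms by (auto intro: convex_body_compact)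
  have zero: "0 \<in> interior K1" "0 \<in> interior K2" using assms convex_body_zero_interior by blast+
  have cap: "compact (K1 \<inter> K2)" "interior (K1 \<inter> K2) \<noteq> {}" using cp zero by auto
  \<comment> \<open>Splitting on the sign avoids evaluating the integral in \<open>Cn n\<close>: in
    the nonpositive case every measure, and so each quotient, is 0.\<close>
  consider "Cn n \<le> 0" | "0 < Cn n" "n = 1" | "0 < Cn n" "2 \<le> n" using \<open>n \<ge> 1\<close> by linarith
  then show ?thesis
  proof cases
    case 1
    then show ?thesis using T by (intro exI[of _ T1] exI[of _ T2]) (simp add: measure_mu2_eq_0)
  next
    case 2
    let ?c = "2 * pi * Cn 1"
    have c: "0 < ?c" using 2 by simp
    have m: "measure (mu2 n) X = ?c * measure gauss2 X" if "X \<in> sets borel" for X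
      using measure_mu2_one[OF that] 2 by simp
    have K: "K1 \<in> sets borel" "K2 \<in> sets borel" "K1 \<inter> K2 \<in> sets borel"
      using cp cap by (auto intro: borel_compact)
    have pos: "0 < measure gauss2 K1" "0 < measure gauss2 K2"
      using zero K by (auto intro!: measure_gauss2_pos)
    have posT: "0 < measure gauss2 T1" "0 < measure gauss2 T2"
    proof -
      have "open T1" "open T2" unfolding T1_def T2_def by (intro open_Collect_less continuous_intros)+
      moreover have "0 \<in> T1" "0 \<in> T2" by (auto simp: T1_def T2_def)
      ultimately show "0 < measure gauss2 T1" "0 < measure gauss2 T2"
        by (intro measure_gauss2_pos; auto simp: interior_open)+
    qed
    have "T1 \<in> sets borel" "T2 \<in> sets borel" "T1 \<inter> T2 \<in> sets borel" using T strip_borel by auto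
    \<comment> \<open>The constant \<open>?c\<close> occurs once above and twice below the fraction
      bar, so it survives as \<open>1 / ?c\<close>.\<close>
    then have "measure (mu2 n) (T1 \<inter> T2) / (measure (mu2 n) T1 * measure (mu2 n) T2) = 1 / ?c"
      using posT c coordinate_strips_independent[folded T1_def T2_def] by (simp add: m)
    also have "\<dots> \<le> measure (mu2 n) (K1 \<inter> K2) / (measure (mu2 n) K1 * measure (mu2 n) K2)"
    proof -
      have "measure gauss2 K1 * measure gauss2 K2 \<le> measure gauss2 (K1 \<inter> K2)"
        using assms cp zero
        by (intro gaussian_correlation_plane)
           (auto simp: centrally_symmetric_def compact_imp_closed intro: convex_body_convex)
      then have "1 \<le> measure gauss2 (K1 \<inter> K2) / (measure gauss2 K1 * measure gauss2 K2)"
        using pos by (simp add: le_divide_eq)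
      then have "1 / ?c \<le> measure gauss2 (K1 \<inter> K2) / (measure gauss2 K1 * measure gauss2 K2) / ?c"
        using c by (intro divide_right_mono) auto
      also have "\<dots> = measure (mu2 n) (K1 \<inter> K2) / (measure (mu2 n) K1 * measure (mu2 n) K2)"
        unfolding m[OF K(1)] m[OF K(2)] m[OF K(3)] using c by (simp only: divide_divide_eq_left) simp
      finally show ?thesis .
    qed
    finally show ?thesis using T by blast
  next
    case 3
    let ?R = "measure (mu2 n) (K1 \<inter> K2) / (measure (mu2 n) K1 * measure (mu2 n) K2)"
    have "0 < measure (mu2 n) (K1 \<inter> K2)" "0 < measure (mu2 n) K1" "0 < measure (mu2 n) K2"
      using 3 cp cap zero by (auto intro!: measure_mu2_pos(2))
    then have "0 < ?R" by simp
    then show ?thesis using thin_strips_ratio_small[OF 3(2,1)] by blast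
  qed
qed

end
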